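(* Let $\gamma:G\to\mathbb R$ and $\kappa:G'\to\mathbb R$ be Reeb graphs of Morse type that are $\epsilon$-interleaved for some $\epsilon\ge0$. Then $$d_b(\mathcal L_0(\gamma),\mathcal L_0(\kappa))\le 5\,d_I(\gamma,\kappa).$$
   Context: Fix a field $k$; homology is singular with coefficients in $k$. A continuous function $\gamma:T\to\mathbb R$ on a topological space is of Morse type if: (1) there is a strictly increasing $\mathcal G:\mathbb Z\to\mathbb R$ with $\lim_{z\to\pm\infty}\mathcal G_z=\pm\infty$ such that for each open interval $I=(\mathcal G_z,\mathcal G_{z+1})$, $\gamma^{-1}(I)$ is homeomorphic to a product $I\times Y$ (with $Y$ depending on $I$) with $\gamma$ corresponding to the projection onto $I$; (2) each such homeomorphism $h:I\times Y\to\gamma^{-1}(I)$ extends to a continuous function $\bar I\times Y\to\gamma^{-1}(\bar I)$, $\bar I$ the closure of $I$; (3) $\dim H_i(\gamma^{-1}(t))<\infty$ for all $t\in\mathbb R$, $i\ge0$. A Reeb graph is a continuous function $\gamma:G\to\mathbb R$ of Morse type, where $G$ is a topological graph and the level sets of $\gamma$ are discrete. In $\mathbb R^{op}\times\mathbb R$, $(a,b)\le(c,d)$ iff $c\le a$ and $b\le d$; $\mathbb U$ is the sub-poset of $(a,b)$ with $a\le b$. The interlevel set filtration $\mathcal S(\gamma):\mathbb U\to\mathrm{Top}$ is $\mathcal S(\gamma)_{(a,b)}=\gamma^{-1}([a,b])$ with inclusion maps. Interleavings of Reeb graphs: a functor $\mathbb U\to\mathrm{Set}$ is extended to $\mathbb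 R^{op}\times\mathbb R\to\mathrm{Set}$ by the value $\emptyset$ at $(a,b)$ with $b<a$. Let $F_\gamma:\mathbb R^{op}\times\mathbb R\to\mathrm{Set}$ be the extension of $\pi_0\circ\mathcal S(\gamma)$, $\pi_0$ being path components. For a functor $F$ on $\mathbb R^{op}\times\mathbb R$ and $\epsilon\ge0$, $F(\epsilon)_{(s,t)}=F_{(s-\epsilon,t+\epsilon)}$ and $\varphi_F^\epsilon:F\to F(\epsilon)$ is given by the internal maps. $\gamma,\kappa$ are $\epsilon$-interleaved if there are natural transformations $f:F_\gamma\to F_\kappa(\epsilon)$, $g:F_\kappa\to F_\gamma(\epsilon)$ with $g(\epsilon)\circ f=\varphi_{F_\gamma}^{2\epsilon}$, $f(\epsilon)\circ g=\varphi_{F_\kappa}^{2\epsilon}$. $d_I(\gamma,\kappa)$ is the infimum of such $\epsilon$. Level set barcodes: for an interval $\mathcal J$ of a poset (nonempty, convex, and connected via finite sequences of comparable elements), $I^{\mathcal J}$ is the functor to $\mathrm{Vec}_k$ equal to $k$ on $\mathcal J$ and $0$ elsewhere, with identity maps within $\mathcal J$ and zero maps otherwise. For $\gamma$ of Morse type it is known that $H_0\mathcal S(\gamma):\mathbb U\to\mathrm{Vec}_k$ decomposes as $\bigoplus_{\mathcal J\in\mathcal B_0(\gamma)}I^{\mathcal J}$ for a unique multiset $\mathcal B_0(\gamma)$ of intervals of $\mathbb U$, each being a block, i.e. of one of the forms $(a,b)_{BL}=\{a<x,\ y<b\}$ ($a<b\in\mathbb R\cup\{\pm\infty\}$), $[a,b)_{BL}=\{a\le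 y<b\}$ ($a\in\mathbb R$, $a<b\le\infty$), $(a,b]_{BL}=\{a<x\le b\}$ ($b\in\mathbb R$, $-\infty\le a<b$), $[a,b]_{BL}=\{x\le b,\ y\ge a\}$ ($a,b\in\mathbb R$), all subsets of points $(x,y)\in\mathbb U$. $\mathcal L_0(\gamma)$ is the multiset of intervals of $\mathbb R$ obtained by intersecting each block in $\mathcal B_0(\gamma)$ with the diagonal $\{(t,t)\}$, discarding empty intersections, and identifying the diagonal with $\mathbb R$. Bottleneck distance on multisets of intervals in $\mathbb R$: for an $\mathbb R$-indexed module $M$ (a functor $M:\mathbb R\to\mathrm{Vec}_k$) and $\epsilon\ge0$, $M(\epsilon)$ is the module $M(\epsilon)_t=M_{t+\epsilon}$ with the evident internal maps, $f(\epsilon)_t=f_{t+\epsilon}$ for a morphism $f$, and $\varphi_M^\epsilon:M\to M(\epsilon)$ is the morphism given by the internal maps $M_t\to M_{t+\epsilon}$. $\mathbb R$-indexed modules $M,N$ are $\epsilon$-interleaved if there are morphisms (natural transformations) $f:M\to N(\epsilon)$, $g:N\to M(\epsilon)$ with $g(\epsilon)\circ f=\varphi_M^{2\epsilon}$ and $f(\epsilon)\circ g=\varphi_N^{2\epsilon}$, and $M$ is $\epsilon$-trivial if $\varphi^\epsilon_M:M\to M(\epsilon)$ is $0$. Intervals $\mathcal J,\mathcal K\subseteq\mathbb R$ are $\epsilon$-interleaved (resp. $\mathcal J$ is $\epsilon$-trivial) if $I^{\mathcal J},I^{\mathcal K}$ are (resp. $I^{\mathcal J}$ is). An $\epsilon$-matching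 between $\mathcal C$ and $\mathcal D$ is a bijection $\sigma$ from a sub-multiset $\mathcal C'\subseteq\mathcal C$ to $\mathcal D'\subseteq\mathcal D$, such that $\mathcal C'$ and $\mathcal D'$ contain all non-$2\epsilon$-trivial intervals of $\mathcal C$ and $\mathcal D$ respectively, and $\mathcal J,\sigma(\mathcal J)$ are $\epsilon$-interleaved for each $\mathcal J\in\mathcal C'$. $d_b(\mathcal C,\mathcal D)$ is the infimum of $\epsilon\ge0$ for which an $\epsilon$-matching exists. *)

theory Defs
  imports "HOL-Homology.Homology" "HOL-Library.Extended_Real"
begin

section \<open>Diagrams of sets and of vector spaces over a poset\<close>

text \<open>
  A functor on a poset is given by its values and its internal maps. A poset is given by a carrier
  and a relation; only internal maps between comparable points of the carrier matter. A vector
  space over the field \<open>'k\<close> is represented by a module record of HOL-Algebra, whose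
  (irrelevant) multiplication and unit are left unspecified.
\<close>

record ('p, 'x) set_diagram =
  set_at :: "'p \<Rightarrow> 'x set"
  set_map :: "'p \<Rightarrow> 'p \<Rightarrow> 'x \<Rightarrow> 'x"

record ('p, 'k, 'v) vec_diagram =
  vec_at :: "'p \<Rightarrow> ('k, 'v) module"
  vec_map :: "'p \<Rightarrow> 'p \<Rightarrow> 'v \<Rightarrow> 'v"

definition set_nat_trans ::
  "'p set \<Rightarrow> ('p \<Rightarrow> 'p \<Rightarrow> bool) \<Rightarrow> ('p, 'x) set_diagram \<Rightarrow> ('p, 'y) set_diagram
    \<Rightarrow> ('p \<Rightarrow> 'x \<Rightarrow> 'y) \<Rightarrow> bool" where
  "set_nat_trans P leq F F' f \<longleftrightarrow>
     (\<forall>p\<in>P. f p \<in> set_at F p \<rightarrow> set_at F' p) \<and>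
     (\<forall>p\<in>P. \<forall>q\<in>P. leq p q \<longrightarrow>
        (\<forall>x\<in>set_at F p. f q (set_map F p q x) = set_map F' p q (f p x)))"

definition linear_map_between ::
  "('k, 'v) module \<Rightarrow> ('k, 'w) module \<Rightarrow> ('v \<Rightarrow> 'w) \<Rightarrow> bool" where
  "linear_map_between V W h \<longleftrightarrow>
     h \<in> carrier V \<rightarrow> carrier W \<and>
     (\<forall>x\<in>carrier V. \<forall>y\<in>carrier V. h (x \<oplus>\<^bsub>V\<^esub> y) = h x \<oplus>\<^bsub>W\<^esub> h y) \<and>
     (\<forall>a. \<forall>x\<in>carrier V. h (a \<odot>\<^bsub>V\<^esub> x) = a \<odot>\<^bsub>W\<^esub> h x)"

definition vec_nat_trans ::
  "'p set \<Rightarrow> ('p \<Rightarrow> 'p \<Rightarrow> bool) \<Rightarrow> ('p, 'k, 'v) vec_diagram \<Rightarrow> ('p, 'k, 'w) vec_diagram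
    \<Rightarrow> ('p \<Rightarrow> 'v \<Rightarrow> 'w) \<Rightarrow> bool" where
  "vec_nat_trans P leq M N f \<longleftrightarrow>
     (\<forall>p\<in>P. linear_map_between (vec_at M p) (vec_at N p) (f p)) \<and>
     (\<forall>p\<in>P. \<forall>q\<in>P. leq p q \<longrightarrow>
        (\<forall>x\<in>carrier (vec_at M p). f q (vec_map M p q x) = vec_map N p q (f p x)))"

definition vec_diagram_iso ::
  "'p set \<Rightarrow> ('p \<Rightarrow> 'p \<Rightarrow> bool) \<Rightarrow> ('p, 'k, 'v) vec_diagram \<Rightarrow> ('p, 'k, 'w) vec_diagram
    \<Rightarrow> bool" where
  "vec_diagram_iso P leq M N \<longleftrightarrow>
     (\<exists>f. vec_nat_trans P leq M N f \<and>
          (\<forall>p\<in>P. bij_betw (f p) (carrier (vec_at M p)) (carrier (vec_at N p))))"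

definition vec_direct_sum ::
  "'i set \<Rightarrow> ('i \<Rightarrow> ('p, 'k, 'v) vec_diagram) \<Rightarrow> ('p, 'k, 'i \<Rightarrow> 'v) vec_diagram" where
  "vec_direct_sum I M =
     \<lparr> vec_at = \<lambda>p.
         \<lparr> carrier = {x \<in> (\<Pi>\<^sub>E i\<in>I. carrier (vec_at (M i) p)).
                        finite {i\<in>I. x i \<noteq> \<zero>\<^bsub>vec_at (M i) p\<^esub>}},
           monoid.mult = undefined, one = undefined,
           zero = (\<lambda>i\<in>I. \<zero>\<^bsub>vec_at (M i) p\<^esub>),
           add = (\<lambda>x y. \<lambda>i\<in>I. x i \<oplus>\<^bsub>vec_at (M i) p\<^esub> y i),
           smult = (\<lambda>a x. \<lambda>i\<in>I. a \<odot>\<^bsub>vec_at (M i) p\<^esub> x i) \<rparr>,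
       vec_map = (\<lambda>p q x. \<lambda>i\<in>I. vec_map (M i) p q (x i)) \<rparr>"

definition poset_interval :: "'p set \<Rightarrow> ('p \<Rightarrow> 'p \<Rightarrow> bool) \<Rightarrow> 'p set \<Rightarrow> bool" where
  "poset_interval P leq J \<longleftrightarrow>
     J \<noteq> {} \<and> J \<subseteq> P \<and>
     (\<forall>p\<in>J. \<forall>r\<in>J. \<forall>q\<in>P. leq p q \<and> leq q r \<longrightarrow> q \<in> J) \<and>
     (\<forall>p\<in>J. \<forall>q\<in>J. (p, q) \<in> {(x, y). x \<in> J \<and> y \<in> J \<and> (leq x y \<or> leq y x)}\<^sup>*)"

definition interval_module :: "'p set \<Rightarrow> ('p, 'k::field, 'k) vec_diagram" where
  "interval_module J =
     \<lparr> vec_at = \<lambda>p.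
         \<lparr> carrier = (if p \<in> J then UNIV else {0}),
           monoid.mult = undefined, one = undefined,
           zero = 0, add = (+), smult = (*) \<rparr>,
       vec_map = (\<lambda>p q x. if p \<in> J \<and> q \<in> J then x else 0) \<rparr>"

section \<open>Singular homology with coefficients in a field\<close>

text \<open>
  The distribution treats integral chains only; the following is the same construction (with the
  same singular simplices and faces) over an arbitrary field \<open>'k\<close>.
\<close>

type_synonym ('a, 'k) kchain = "((nat \<Rightarrow> real) \<Rightarrow> 'a) \<Rightarrow>\<^sub>0 'k"

definition kscale :: "'k::field \<Rightarrow> ('s \<Rightarrow>\<^sub>0 'k) \<Rightarrow> ('s \<Rightarrow>\<^sub>0 'k)" where
  "kscale a c = Poly_Mapping.map ((*) a) c"

definition kextend :: "('s \<Rightarrow> ('t \<Rightarrow>\<^sub>0 'k::field)) \<Rightarrow> ('s \<Rightarrow>\<^sub>0 'k) \<Rightarrow> ('t \<Rightarrow>\<^sub>0 'k)" where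
  "kextend b c = (\<Sum>s\<in>Poly_Mapping.keys c. kscale (Poly_Mapping.lookup c s) (b s))"

definition kchains :: "nat \<Rightarrow> 'a topology \<Rightarrow> ('a, 'k::field) kchain set" where
  "kchains p X = {c. Poly_Mapping.keys c \<subseteq> singular_simplex_set p X}"

definition kboundary :: "nat \<Rightarrow> ('a, 'k::field) kchain \<Rightarrow> ('a, 'k) kchain" where
  "kboundary p c =
     (if p = 0 then 0
      else kextend (\<lambda>s. \<Sum>j\<le>p. Poly_Mapping.single (singular_face p j s) ((-1) ^ j)) c)"

definition kcycles :: "nat \<Rightarrow> 'a topology \<Rightarrow> ('a, 'k::field) kchain set" where
  "kcycles p X = {c \<in> kchains p X. kboundary p c = 0}"

definition kboundaries :: "nat \<Rightarrow> 'a topology \<Rightarrow> ('a, 'k::field) kchain set" where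
  "kboundaries p X = kboundary (Suc p) ` kchains (Suc p) X"

definition khomology :: "nat \<Rightarrow> 'a topology \<Rightarrow> ('k::field, ('a, 'k) kchain set) module" where
  "khomology p X =
     \<lparr> carrier = (\<lambda>z. {z + b | b. b \<in> kboundaries p X}) ` kcycles p X,
       monoid.mult = undefined, one = undefined,
       zero = kboundaries p X,
       add = (\<lambda>C D. {c + d | c d. c \<in> C \<and> d \<in> D}),
       smult = (\<lambda>a C. {kscale a c + b | c b. c \<in> C \<and> b \<in> kboundaries p X}) \<rparr>"

text \<open>
  The map on homology induced by a continuous map \<open>g\<close> into \<open>Y\<close>: the image of a class is the class
  in \<open>Y\<close> of the images of its representatives.
\<close>

definition khomology_map ::
  "nat \<Rightarrow> ('a \<Rightarrow> 'b) \<Rightarrow> 'b topology \<Rightarrow> ('a, 'k::field) kchain set \<Rightarrow> ('b, 'k) kchain set" where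
  "khomology_map p g Y C =
     {kextend (\<lambda>s. Poly_Mapping.single (simplex_map p g s) 1) z + b
        | z b. z \<in> C \<and> b \<in> kboundaries p Y}"

definition fin_dim_space :: "('k, 'v) module \<Rightarrow> bool" where
  "fin_dim_space V \<longleftrightarrow>
     (\<exists>S\<subseteq>carrier V. finite S \<and> (\<forall>v\<in>carrier V. \<exists>a. v = (\<Oplus>\<^bsub>V\<^esub>s\<in>S. a s \<odot>\<^bsub>V\<^esub> s)))"

section \<open>Morse type functions and Reeb graphs\<close>

definition preimage_space :: "'a topology \<Rightarrow> ('a \<Rightarrow> real) \<Rightarrow> real set \<Rightarrow> 'a topology" where
  "preimage_space X \<gamma> A = subtopology X {x \<in> topspace X. \<gamma> x \<in> A}"

text \<open>
  The homeomorphism chosen over each open interval is required to extend. The fibre \<open>Y\<close> may be taken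
  with points in \<open>'a\<close> without loss of generality, being homeomorphic to any level set over the
  (nonempty) interval. The type argument is the coefficient field.
\<close>

definition morse_type :: "'k::field itself \<Rightarrow> 'a topology \<Rightarrow> ('a \<Rightarrow> real) \<Rightarrow> bool" where
  "morse_type _ X \<gamma> \<longleftrightarrow>
     continuous_map X euclideanreal \<gamma> \<and>
     (\<exists>\<G> :: int \<Rightarrow> real.
        strict_mono \<G> \<and> filterlim \<G> at_top at_top \<and> filterlim \<G> at_bot at_bot \<and>
        (\<forall>z. \<exists>(Y :: 'a topology) h.
           homeomorphic_map
             (prod_topology (top_of_set {\<G> z<..<\<G> (z + 1)}) Y)
             (preimage_space X \<gamma> {\<G> z<..<\<G> (z + 1)}) h \<and>
           (\<forall>t\<in>{\<G> z<..<\<G> (z + 1)}. \<forall>y\<in>topspace Y. \<gamma> (h (t, y)) = t) \<and>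
           (\<exists>h'. continuous_map
                    (prod_topology (top_of_set {\<G> z..\<G> (z + 1)}) Y)
                    (preimage_space X \<gamma> {\<G> z..\<G> (z + 1)}) h' \<and>
                 (\<forall>t\<in>{\<G> z<..<\<G> (z + 1)}. \<forall>y\<in>topspace Y. h' (t, y) = h (t, y))))) \<and>
     (\<forall>t i. fin_dim_space
              (khomology i (preimage_space X \<gamma> {t}) :: ('k, ('a, 'k) kchain set) module))"

text \<open>
  A topological graph is a CW complex of dimension at most 1, i.e. the quotient of the disjoint
  union of a discrete set \<open>V\<close> of vertices and of copies of \<open>[0,1]\<close>, one for each edge, obtained by
  gluing the end points of the edges to vertices (loops and multiple edges are allowed); the last
  clause says that \<open>X\<close> carries the quotient topology. Distinct edges have distinct midpoints, so
  the points of \<open>'a\<close> suffice to label edges.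
\<close>

definition topological_graph :: "'a topology \<Rightarrow> bool" where
  "topological_graph X \<longleftrightarrow>
     (\<exists>(V :: 'a set) (E :: 'a set) (\<phi> :: 'a \<Rightarrow> real \<Rightarrow> 'a).
        topspace X = V \<union> (\<Union>e\<in>E. \<phi> e ` {0<..<1}) \<and>
        (\<forall>e\<in>E. \<phi> e 0 \<in> V \<and> \<phi> e 1 \<in> V) \<and>
        V \<inter> (\<Union>e\<in>E. \<phi> e ` {0<..<1}) = {} \<and>
        inj_on (\<lambda>(e, s). \<phi> e s) (E \<times> {0<..<1}) \<and>
        (\<forall>U\<subseteq>topspace X.
           openin X U \<longleftrightarrow> (\<forall>e\<in>E. openin (top_of_set {0..1}) {s \<in> {0..1}. \<phi> e s \<in> U})))"

definition reeb_graph :: "'k::field itself \<Rightarrow> 'a topology \<Rightarrow> ('a \<Rightarrow> real) \<Rightarrow> bool" where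
  "reeb_graph k X \<gamma> \<longleftrightarrow>
     topological_graph X \<and> morse_type k X \<gamma> \<and>
     (\<forall>t. preimage_space X \<gamma> {t} = discrete_topology {x \<in> topspace X. \<gamma> x = t})"

section \<open>Interlevel sets and interleavings of Reeb graphs\<close>

definition le_oprr :: "real \<times> real \<Rightarrow> real \<times> real \<Rightarrow> bool" where
  "le_oprr p q \<longleftrightarrow> fst q \<le> fst p \<and> snd p \<le> snd q"

definition upper_half :: "(real \<times> real) set" where
  "upper_half = {(a, b). a \<le> b}"

definition interlevel :: "'a topology \<Rightarrow> ('a \<Rightarrow> real) \<Rightarrow> real \<times> real \<Rightarrow> 'a topology" where
  "interlevel X \<gamma> p = preimage_space X \<gamma> {fst p..snd p}"

definition reeb_functor ::
  "'a topology \<Rightarrow> ('a \<Rightarrow> real) \<Rightarrow> (real \<times> real, 'a set) set_diagram" where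
  "reeb_functor X \<gamma> =
     \<lparr> set_at = \<lambda>p. if p \<in> upper_half then path_components_of (interlevel X \<gamma> p) else {},
       set_map = \<lambda>p q C. THE D. D \<in> path_components_of (interlevel X \<gamma> q) \<and> C \<subseteq> D \<rparr>"

definition shift2 :: "real \<Rightarrow> real \<times> real \<Rightarrow> real \<times> real" where
  "shift2 \<epsilon> p = (fst p - \<epsilon>, snd p + \<epsilon>)"

definition set_diagram_shift ::
  "real \<Rightarrow> (real \<times> real, 'x) set_diagram \<Rightarrow> (real \<times> real, 'x) set_diagram" where
  "set_diagram_shift \<epsilon> F =
     \<lparr> set_at = \<lambda>p. set_at F (shift2 \<epsilon> p),
       set_map = \<lambda>p q. set_map F (shift2 \<epsilon> p) (shift2 \<epsilon> q) \<rparr>"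

definition set_interleaved ::
  "real \<Rightarrow> (real \<times> real, 'x) set_diagram \<Rightarrow> (real \<times> real, 'y) set_diagram \<Rightarrow> bool" where
  "set_interleaved \<epsilon> F F' \<longleftrightarrow>
     (\<exists>f g. set_nat_trans UNIV le_oprr F (set_diagram_shift \<epsilon> F') f \<and>
            set_nat_trans UNIV le_oprr F' (set_diagram_shift \<epsilon> F) g \<and>
            (\<forall>p. \<forall>x\<in>set_at F p. g (shift2 \<epsilon> p) (f p x) = set_map F p (shift2 (2 * \<epsilon>) p) x) \<and>
            (\<forall>p. \<forall>y\<in>set_at F' p. f (shift2 \<epsilon> p) (g p y) = set_map F' p (shift2 (2 * \<epsilon>) p) y))"

definition reeb_interleaved ::
  "real \<Rightarrow> 'a topology \<Rightarrow> ('a \<Rightarrow> real) \<Rightarrow> 'b topology \<Rightarrow> ('b \<Rightarrow> real) \<Rightarrow> bool" where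
  "reeb_interleaved \<epsilon> X \<gamma> Y \<kappa> \<longleftrightarrow>
     set_interleaved \<epsilon> (reeb_functor X \<gamma>) (reeb_functor Y \<kappa>)"

definition reeb_distance ::
  "'a topology \<Rightarrow> ('a \<Rightarrow> real) \<Rightarrow> 'b topology \<Rightarrow> ('b \<Rightarrow> real) \<Rightarrow> ereal" where
  "reeb_distance X \<gamma> Y \<kappa> = Inf {ereal \<epsilon> | \<epsilon>. 0 \<le> \<epsilon> \<and> reeb_interleaved \<epsilon> X \<gamma> Y \<kappa>}"

section \<open>Level set barcodes\<close>

definition interlevel_homology ::
  "nat \<Rightarrow> 'a topology \<Rightarrow> ('a \<Rightarrow> real)
    \<Rightarrow> (real \<times> real, 'k::field, ('a, 'k) kchain set) vec_diagram" where
  "interlevel_homology n X \<gamma> =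
     \<lparr> vec_at = \<lambda>p. khomology n (interlevel X \<gamma> p),
       vec_map = \<lambda>p q. khomology_map n (\<lambda>x. x) (interlevel X \<gamma> q) \<rparr>"

definition block_oo :: "ereal \<Rightarrow> ereal \<Rightarrow> (real \<times> real) set" where
  "block_oo a b = {(x, y) \<in> upper_half. a < ereal x \<and> ereal y < b}"

definition block_co :: "real \<Rightarrow> ereal \<Rightarrow> (real \<times> real) set" where
  "block_co a b = {(x, y) \<in> upper_half. a \<le> y \<and> ereal y < b}"

definition block_oc :: "ereal \<Rightarrow> real \<Rightarrow> (real \<times> real) set" where
  "block_oc a b = {(x, y) \<in> upper_half. a < ereal x \<and> x \<le> b}"

definition block_cc :: "real \<Rightarrow> real \<Rightarrow> (real \<times> real) set" where
  "block_cc a b = {(x, y) \<in> upper_half. x \<le> b \<and> a \<le> y}"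

definition is_block :: "(real \<times> real) set \<Rightarrow> bool" where
  "is_block J \<longleftrightarrow>
     (\<exists>a b. a < b \<and> J = block_oo a b) \<or>
     (\<exists>a b. ereal a < b \<and> J = block_co a b) \<or>
     (\<exists>a b. a < ereal b \<and> J = block_oc a b) \<or>
     (\<exists>a b. J = block_cc a b)"

text \<open>
  A (possibly infinite) multiset is represented by a family indexed by a set: an element occurs as
  many times as it has indices.
\<close>

type_synonym ('i, 'x) family = "'i set \<times> ('i \<Rightarrow> 'x)"

text \<open>
  The barcode \<open>\<B>\<^sub>0(\<gamma>)\<close>, which is unique as a multiset, is characterised by the decomposition that
  defines it.
\<close>

definition is_block_barcode0 ::
  "'k::field itself \<Rightarrow> 'a topology \<Rightarrow> ('a \<Rightarrow> real) \<Rightarrow> ('i, (real \<times> real) set) family \<Rightarrow> bool" where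
  "is_block_barcode0 _ X \<gamma> B \<longleftrightarrow>
     (\<forall>i\<in>fst B. poset_interval upper_half le_oprr (snd B i) \<and> is_block (snd B i)) \<and>
     vec_diagram_iso upper_half le_oprr
       (interlevel_homology 0 X \<gamma> :: (real \<times> real, 'k, ('a, 'k) kchain set) vec_diagram)
       (vec_direct_sum (fst B) (\<lambda>i. interval_module (snd B i)))"

definition diagonal_part :: "(real \<times> real) set \<Rightarrow> real set" where
  "diagonal_part J = {t. (t, t) \<in> J}"

text \<open>The passage from \<open>\<B>\<^sub>0(\<gamma>)\<close> to \<open>\<L>\<^sub>0(\<gamma>)\<close>.\<close>

definition level_barcode :: "('i, (real \<times> real) set) family \<Rightarrow> ('i, real set) family" where
  "level_barcode B =
     ({i \<in> fst B. diagonal_part (snd B i) \<noteq> {}}, \<lambda>i. diagonal_part (snd B i))"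

section \<open>Bottleneck distance\<close>

definition vec_diagram_shift ::
  "real \<Rightarrow> (real, 'k, 'v) vec_diagram \<Rightarrow> (real, 'k, 'v) vec_diagram" where
  "vec_diagram_shift \<epsilon> M =
     \<lparr> vec_at = \<lambda>t. vec_at M (t + \<epsilon>), vec_map = \<lambda>s t. vec_map M (s + \<epsilon>) (t + \<epsilon>) \<rparr>"

definition vec_interleaved ::
  "real \<Rightarrow> (real, 'k, 'v) vec_diagram \<Rightarrow> (real, 'k, 'w) vec_diagram \<Rightarrow> bool" where
  "vec_interleaved \<epsilon> M N \<longleftrightarrow>
     (\<exists>f g. vec_nat_trans UNIV (\<le>) M (vec_diagram_shift \<epsilon> N) f \<and>
            vec_nat_trans UNIV (\<le>) N (vec_diagram_shift \<epsilon> M) g \<and>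
            (\<forall>t. \<forall>x\<in>carrier (vec_at M t). g (t + \<epsilon>) (f t x) = vec_map M t (t + 2 * \<epsilon>) x) \<and>
            (\<forall>t. \<forall>y\<in>carrier (vec_at N t). f (t + \<epsilon>) (g t y) = vec_map N t (t + 2 * \<epsilon>) y))"

definition vec_trivial :: "real \<Rightarrow> (real, 'k, 'v) vec_diagram \<Rightarrow> bool" where
  "vec_trivial \<epsilon> M \<longleftrightarrow>
     (\<forall>t. \<forall>x\<in>carrier (vec_at M t). vec_map M t (t + \<epsilon>) x = \<zero>\<^bsub>vec_at M (t + \<epsilon>)\<^esub>)"

definition interval_interleaved ::
  "'k::field itself \<Rightarrow> real \<Rightarrow> real set \<Rightarrow> real set \<Rightarrow> bool" where
  "interval_interleaved _ \<epsilon> J K \<longleftrightarrow>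
     vec_interleaved \<epsilon> (interval_module J :: (real, 'k, 'k) vec_diagram)
                       (interval_module K :: (real, 'k, 'k) vec_diagram)"

definition interval_trivial :: "'k::field itself \<Rightarrow> real \<Rightarrow> real set \<Rightarrow> bool" where
  "interval_trivial _ \<epsilon> J \<longleftrightarrow> vec_trivial \<epsilon> (interval_module J :: (real, 'k, 'k) vec_diagram)"

definition eps_matching ::
  "'k::field itself \<Rightarrow> real \<Rightarrow> ('i, real set) family \<Rightarrow> ('j, real set) family
    \<Rightarrow> 'i set \<Rightarrow> 'j set \<Rightarrow> ('i \<Rightarrow> 'j) \<Rightarrow> bool" where
  "eps_matching k \<epsilon> C D I J \<sigma> \<longleftrightarrow>
     I \<subseteq> fst C \<and> J \<subseteq> fst D \<and> bij_betw \<sigma> I J \<and>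
     (\<forall>i\<in>fst C. \<not> interval_trivial k (2 * \<epsilon>) (snd C i) \<longrightarrow> i \<in> I) \<and>
     (\<forall>j\<in>fst D. \<not> interval_trivial k (2 * \<epsilon>) (snd D j) \<longrightarrow> j \<in> J) \<and>
     (\<forall>i\<in>I. interval_interleaved k \<epsilon> (snd C i) (snd D (\<sigma> i)))"

text \<open>The infimum is taken in the extended reals, so it is infinite if there is no matching.\<close>

definition bottleneck_distance ::
  "'k::field itself \<Rightarrow> ('i, real set) family \<Rightarrow> ('j, real set) family \<Rightarrow> ereal" where
  "bottleneck_distance k C D =
     Inf {ereal \<epsilon> | \<epsilon>. 0 \<le> \<epsilon> \<and> (\<exists>I J \<sigma>. eps_matching k \<epsilon> C D I J \<sigma>)}"

end

theory Submission
  imports Defs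
begin

text \<open>
  A Reeb graph interleaving induces an interleaving of the zeroth interlevel set homology modules,
  because in degree zero a map of path components is realised by any choice of points in the image
  components. In terms of the block decompositions it becomes a pair of matrices. Blocks are closed
  under joins, so each matrix entry is a constant scalar, and it can only be nonzero if the ends of
  the two blocks satisfy four inequalities. For long bars, ordered by kind and by a signed sum of the
  end points, the product of the two matrices is triangular already if only the bars close to the
  given ones are kept as intermediate indices. Comparing ranks gives the marriage condition, and
  the matchings in both directions are merged as in the Cantor--Bernstein theorem. Matched bars have
  ends of the same type at distance at most \<open>\<epsilon>\<close>, and unmatched ones are too short to matter.
\<close>

section \<open>Marriage theorem and triangular products\<close>

text \<open>The scalars of a composite carry information only if some point \<open>p\<close> lies in
  the first outer block and its shift by \<open>2 * \<epsilon>\<close> in the second; otherwise the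
  composite is zero whatever the scalars are. The length of the bars serves to produce such a point,
  and it is guaranteed only for pairs ordered in the right way by kind and signed sum. Hence the
  product of the two matrices is controlled on one side of the diagonal only, and triangularity has
  to replace invertibility. The second obstacle is that intermediate bars may be far from both outer
  ones, while a matching may use near bars only. The signs in the sum are chosen so that each end,
  taken with its sign, grows by at most \<open>\<epsilon>\<close> along a morphism; an intermediate
  bar far from both neighbours would make the sum drop. Barcodes may be infinite, so the marriage
  theorem is needed for infinite families of finite sets; the finiteness comes from the homology of
  the level sets. The factor 5 enters through the meaning of long: a matching at level
  \<open>5 * \<epsilon>\<close> must contain every bar that is not trivial at
  \<open>10 * \<epsilon>\<close>.\<close>

lemma exists_injective_choice:
  fixes X :: "'a set" and N :: "'a \<Rightarrow> 'b set"
  assumes fin: "\<And>x. x \<in> X \<Longrightarrow> finite (N x)"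
    and hall: "\<And>A. finite A \<Longrightarrow> A \<subseteq> X \<Longrightarrow> card A \<le> card (\<Union>x\<in>A. N x)"
  shows "\<exists>f. inj_on f X \<and> (\<forall>x\<in>X. f x \<in> N x)"
proof -
  define E where "E = Sigma X N"
  define good where "good R \<longleftrightarrow> (\<forall>A. finite A \<and> A \<subseteq> X \<longrightarrow> card A \<le> card (R `` A))"
    for R :: "('a \<times> 'b) set"
  \<comment> \<open>Rado's argument: edges are deleted as long as Hall's condition survives. After a
    maximal deletion every remaining edge is indispensable.\<close>
  define \<A> where "\<A> = {D. D \<subseteq> E \<and> good (E - D)}"
  have finE: "finite (R `` A)" if "R \<subseteq> E" "finite A" for R A
  proof (rule finite_subset)
    show "R `` A \<subseteq> (\<Union>x\<in>A \<inter> X. N x)"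
      using that by (auto simp: E_def)
  qed (use that fin in auto)
  have "\<Union>\<C> \<in> \<A>" if chain: "subset.chain \<A> \<C>" for \<C>
  proof -
    have sub: "\<Union>\<C> \<subseteq> E"
      using chain by (auto simp: \<A>_def subset_chain_def)
    have "card A \<le> card ((E - \<Union>\<C>) `` A)" if A: "finite A" "A \<subseteq> X" for A
    proof (cases "\<C> = {}")
      case True
      have "(E - \<Union>\<C>) `` A = (\<Union>x\<in>A. N x)"
        using True A by (auto simp: E_def)
      then show ?thesis
        using hall A by simp
    next
      case False
      \<comment> \<open>Only finitely many edges start in \<open>A\<close>, so those of them deleted
        by the union are already deleted by one member of the chain.\<close>
      let ?F = "(E \<inter> A \<times> UNIV) \<inter> \<Union>\<C>"
      have "E \<inter> A \<times> UNIV \<subseteq> Sigma A N"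
        by (auto simp: E_def)
      moreover have "finite (Sigma A N)"
        using A(1) by (rule finite_SigmaI) (use A(2) fin in auto)
      ultimately have "finite ?F"
        by (meson finite_Int finite_subset)
      then obtain D where D: "D \<in> \<C>" "?F \<subseteq> D"
        by (rule finite_subset_Union_chain[OF _ Int_lower2 False chain])
      then have eq: "(E - \<Union>\<C>) `` A = (E - D) `` A"
        by (auto simp: Image_iff)
      have "good (E - D)"
        using D chain by (auto simp: \<A>_def subset_chain_def)
      then show ?thesis
        using A eq by (simp add: good_def)
    qed
    then show ?thesis
      using sub by (auto simp: \<A>_def good_def)
  qed
  then have "\<exists>M\<in>\<A>. \<forall>X\<in>\<A>. M \<subseteq> X \<longrightarrow> X = M"
    by (rule subset_Zorn')
  then obtain D where D: "D \<in> \<A>" and max: "\<And>D'. D' \<in> \<A> \<Longrightarrow> D \<subseteq> D' \<Longrightarrow> D' = D"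
    by blast
  define R where "R = E - D"
  have R: "R \<subseteq> E" "good R"
    using D by (auto simp: R_def \<A>_def)
  have hallR: "card A \<le> card (R `` A)" if "finite A" "A \<subseteq> X" for A
    using R(2) that by (simp add: good_def)
  have deficient: "\<exists>A. finite A \<and> A \<subseteq> X \<and> x \<in> A \<and> card ((R - {(x, y)}) `` A) < card A"
    if "(x, y) \<in> R" for x y
  proof -
    have ins: "insert (x, y) D \<noteq> D" "insert (x, y) D \<subseteq> E"
      using that D by (auto simp: R_def \<A>_def)
    have "\<not> good (E - insert (x, y) D)"
    proof
      assume "good (E - insert (x, y) D)"
      then have "insert (x, y) D \<in> \<A>"
        using ins(2) by (simp add: \<A>_def)
      from max[OF this subset_insertI] show False
        using ins(1) by contradiction
    qed
    moreover have "E - insert (x, y) D = R - {(x, y)}"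
      by (auto simp: R_def)
    ultimately obtain A where A: "finite A" "A \<subseteq> X" "card ((R - {(x, y)}) `` A) < card A"
      by (auto simp: good_def not_le)
    moreover have "x \<in> A"
    proof (rule ccontr)
      assume "x \<notin> A"
      then have "(R - {(x, y)}) `` A = R `` A"
        by auto
      then show False
        using hallR[OF A(1,2)] A(3) by simp
    qed
    ultimately show ?thesis
      by blast
  qed
  \<comment> \<open>Two edges at \<open>x\<close> would give deficient sets \<open>A1\<close> and
    \<open>A2\<close>, contradicting submodularity. Over the union nothing is lost, since each edge
    survives the removal of the other; over the intersection only \<open>x\<close> is given up. Two
    deficits of at least 1 do not fit into this loss of 1.\<close>
  have uniq: "y1 = y2" if xy: "(x, y1) \<in> R" "(x, y2) \<in> R" for x y1 y2
  proof (rule ccontr)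
    assume ne: "y1 \<noteq> y2"
    obtain A1 A2 where A1: "finite A1" "A1 \<subseteq> X" "x \<in> A1" "card ((R - {(x, y1)}) `` A1) < card A1"
      and A2: "finite A2" "A2 \<subseteq> X" "x \<in> A2" "card ((R - {(x, y2)}) `` A2) < card A2"
      using deficient xy by meson
    let ?P1 = "(R - {(x, y1)}) `` A1" and ?P2 = "(R - {(x, y2)}) `` A2"
    have fin12: "finite ?P1" "finite ?P2"
      using finE R(1) A1(1) A2(1) by (meson Diff_subset subset_trans)+
    have hallP: "card A \<le> card P" if "A \<subseteq> X" "finite A" "R `` A \<subseteq> P" "finite P" for A P
      using hallR[OF that(2,1)] card_mono[OF that(4,3)] by linarith
    have "card (A1 \<union> A2) \<le> card (?P1 \<union> ?P2)"
    proof (rule hallP)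
      show "R `` (A1 \<union> A2) \<subseteq> ?P1 \<union> ?P2"
        using ne A1(3) A2(3) by auto
    qed (use A1 A2 fin12 in auto)
    moreover have "card (A1 \<inter> A2 - {x}) \<le> card (?P1 \<inter> ?P2)"
      by (rule hallP) (use A1 A2 fin12 in auto)
    moreover have "card (A1 \<inter> A2) \<le> Suc (card (A1 \<inter> A2 - {x}))"
      using A1(1,3) A2(3) by (simp add: card_Suc_Diff1)
    ultimately show False
      using card_Un_Int[OF fin12] card_Un_Int[OF A1(1) A2(1)] A1(4) A2(4) by linarith
  qed
  have ex: "\<exists>y. (x, y) \<in> R" if "x \<in> X" for x
  proof (rule ccontr)
    assume "\<nexists>y. (x, y) \<in> R"
    then have "R `` {x} = {}"
      by blast
    moreover have "card {x} \<le> card (R `` {x})"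
      by (rule hallR) (use that in auto)
    ultimately show False
      by simp
  qed
  define f where "f x = (SOME y. (x, y) \<in> R)" for x
  have f: "(x, f x) \<in> R" if "x \<in> X" for x
    unfolding f_def using ex[OF that] by (rule someI_ex)
  have "inj_on f X"
  proof (rule inj_onI, rule ccontr)
    fix x x'
    assume x: "x \<in> X" "x' \<in> X" "f x = f x'" "x \<noteq> x'"
    have "R `` {x, x'} \<subseteq> {f x}"
      using uniq[OF f[OF x(1)]] uniq[OF f[OF x(2)]] x(3) by auto
    then have "card (R `` {x, x'}) \<le> 1"
      using card_mono[of "{f x}"] by fastforce
    moreover have "card {x, x'} \<le> card (R `` {x, x'})"
      by (rule hallR) (use x in auto)
    ultimately show False
      using x by simp
  qed
  moreover have "\<forall>x\<in>X. f x \<in> N x"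
    using f R(1) by (auto simp: E_def)
  ultimately show ?thesis
    by (intro exI conjI)
qed

text \<open>This is the Mendelsohn-Dulmage theorem. Here \<open>m\<close> may leave \<open>Y\<close>
  and \<open>m'\<close> may leave \<open>X\<close>, so the matching can involve further indices, but
  only ones that \<open>m\<close> or \<open>m'\<close> hits.\<close>

lemma merge_injections:
  assumes m: "inj_on m X" "\<And>x. x \<in> X \<Longrightarrow> E x (m x)"
    and m': "inj_on m' Y" "\<And>y. y \<in> Y \<Longrightarrow> E (m' y) y"
  shows "\<exists>\<sigma> I J. bij_betw \<sigma> I J \<and> X \<subseteq> I \<and> Y \<subseteq> J \<and> I \<subseteq> X \<union> m' ` Y \<and> J \<subseteq> Y \<union> m ` X \<and>
    (\<forall>i\<in>I. E i (\<sigma> i))"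
proof -
  \<comment> \<open>The points reached by walks that start in \<open>X\<close> outside the image of
    \<open>m'\<close> and alternate between \<open>m\<close> and \<open>m'\<close>. The matching
    follows \<open>m\<close> on these walks and the inverse of \<open>m'\<close> elsewhere.\<close>
  define S where "S = lfp (\<lambda>S. {x \<in> X. x \<in> m' ` Y \<longrightarrow> (\<exists>s\<in>S. s \<in> X \<and> m s \<in> Y \<and> x = m' (m s))})"
  have S: "S = {x \<in> X. x \<in> m' ` Y \<longrightarrow> (\<exists>s\<in>S. s \<in> X \<and> m s \<in> Y \<and> x = m' (m s))}"
    unfolding S_def by (rule lfp_unfold) (auto intro!: monoI)
  have SX: "S \<subseteq> X"
    using S by blast
  define T where "T = Y - m ` S"
  define \<sigma> where "\<sigma> i = (if i \<in> S then m i else inv_into Y m' i)" for i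
  have disj: "m' y \<notin> S" if "y \<in> T" for y
  proof
    assume "m' y \<in> S"
    moreover have y: "y \<in> Y" "y \<notin> m ` S"
      using that by (auto simp: T_def)
    ultimately obtain s where "s \<in> S" "m s \<in> Y" "m' y = m' (m s)"
      using S by blast
    then show False
      using m'(1) y by (metis imageI inj_onD)
  qed
  have \<sigma>T: "\<sigma> (m' y) = y" if "y \<in> T" for y
    using that disj m'(1) by (auto simp: \<sigma>_def T_def)
  have "bij_betw \<sigma> (S \<union> m' ` T) (m ` S \<union> T)"
  proof (rule bij_betw_combine)
    show "bij_betw \<sigma> S (m ` S)"
      using inj_on_subset[OF m(1) SX] by (simp add: bij_betw_def \<sigma>_def inj_on_def)
    show "bij_betw \<sigma> (m' ` T) T"
      by (rule bij_betw_byWitness[where f' = m']) (use \<sigma>T in auto)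
    show "m ` S \<inter> T = {}"
      by (auto simp: T_def)
  qed
  moreover have "X \<subseteq> S \<union> m' ` T"
  proof
    fix x
    assume x: "x \<in> X"
    show "x \<in> S \<union> m' ` T"
    proof (cases "x \<in> m' ` T")
      case False
      then have "x \<in> m' ` Y \<longrightarrow> (\<exists>s\<in>S. s \<in> X \<and> m s \<in> Y \<and> x = m' (m s))"
        using SX unfolding T_def by blast
      then show ?thesis
        using x S by blast
    qed simp
  qed
  moreover have "Y \<subseteq> m ` S \<union> T"
    by (auto simp: T_def)
  moreover have "S \<union> m' ` T \<subseteq> X \<union> m' ` Y" "m ` S \<union> T \<subseteq> Y \<union> m ` X"
    using SX by (auto simp: T_def)
  moreover have "E i (\<sigma> i)" if "i \<in> S" for i
    using that m(2) SX by (auto simp: \<sigma>_def)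
  moreover have "E (m' y) (\<sigma> (m' y))" if "y \<in> T" for y
    using that m'(2) \<sigma>T by (auto simp: T_def)
  ultimately show ?thesis
    by (intro exI[of _ \<sigma>] exI[of _ "S \<union> m' ` T"] exI[of _ "m ` S \<union> T"]) auto
qed

section \<open>Linear dependence and triangular products\<close>

lemma exists_nontrivial_relation:
  fixes F :: "'a \<Rightarrow> 'm \<Rightarrow> 'k::field"
  assumes "finite M" "finite A" "card M < card A"
  shows "\<exists>c. (\<exists>i\<in>A. c i \<noteq> 0) \<and> (\<forall>j\<in>M. (\<Sum>i\<in>A. c i * F i j) = 0)"
  using assms
proof (induction M arbitrary: A F rule: finite_induct)
  case empty
  then have "A \<noteq> {}"
    by auto
  then show ?case
    by (intro exI[of _ "\<lambda>_. 1"]) auto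
next
  case (insert j M)
  show ?case
  proof (cases "\<forall>i\<in>A. F i j = 0")
    case True
    then show ?thesis
      using insert.IH[of A F] insert.prems insert.hyps by auto
  next
    case False
    then obtain i0 where i0: "i0 \<in> A" "F i0 j \<noteq> 0"
      by blast
    define A' where "A' = A - {i0}"
    define F' where "F' i m = F i m - F i j / F i0 j * F i0 m" for i m
    have A': "finite A'" "card M < card A'" "A = insert i0 A'" "i0 \<notin> A'"
      using insert.prems insert.hyps i0 by (auto simp: A'_def)
    obtain c where c: "\<exists>i\<in>A'. c i \<noteq> 0" "\<forall>m\<in>M. (\<Sum>i\<in>A'. c i * F' i m) = 0"
      using insert.IH[OF A'(1,2), of F'] by blast
    \<comment> \<open>\<open>F'\<close> clears column \<open>j\<close> with the pivot row
      \<open>i0\<close>; the coefficient at \<open>i0\<close> is the one that makes this column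
      cancel.\<close>
    define d where "d = c(i0 := - (\<Sum>i\<in>A'. c i * F i j) / F i0 j)"
    have sum_d: "(\<Sum>i\<in>A. d i * F i m) = d i0 * F i0 m + (\<Sum>i\<in>A'. c i * F i m)" for m
    proof -
      have "(\<Sum>i\<in>A'. d i * F i m) = (\<Sum>i\<in>A'. c i * F i m)"
        by (rule sum.cong) (use A'(4) in \<open>auto simp: d_def\<close>)
      then show ?thesis
        using A' by simp
    qed
    have "(\<Sum>i\<in>A'. c i * F' i m) = (\<Sum>i\<in>A'. c i * F i m) + d i0 * F i0 m" for m
    proof -
      have "(\<Sum>i\<in>A'. c i * F' i m) =
          (\<Sum>i\<in>A'. c i * F i m) - (\<Sum>i\<in>A'. c i * F i j * (F i0 m / F i0 j))"
        unfolding sum_subtractf[symmetric]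
        by (rule sum.cong) (simp_all add: F'_def algebra_simps)
      also have "(\<Sum>i\<in>A'. c i * F i j * (F i0 m / F i0 j)) = - d i0 * F i0 m"
        unfolding sum_distrib_right[symmetric] using i0 by (simp add: d_def)
      finally show ?thesis
        by simp
    qed
    then have "\<forall>m\<in>M. (\<Sum>i\<in>A. d i * F i m) = 0"
      using c(2) by (simp add: sum_d add.commute)
    moreover have "(\<Sum>i\<in>A. d i * F i j) = 0"
      unfolding sum_d using i0 by (simp add: d_def)
    moreover have "\<exists>i\<in>A. d i \<noteq> 0"
      using c(1) A' by (auto simp: d_def)
    ultimately show ?thesis
      by blast
  qed
qed

text \<open>With more rows than columns, some combination \<open>c\<close> of the rows of
  \<open>F\<close> vanishes. Multiplied by the column of \<open>G\<close> at an index
  \<open>m\<close> that is maximal in the support of \<open>c\<close>, it leaves \<open>c m\<close>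
  alone, which must be 0. The relation \<open>R\<close> enters only through such maximal
  elements.\<close>

lemma card_le_of_triangular_product:
  fixes F :: "'a \<Rightarrow> 'm \<Rightarrow> 'k::field"
  assumes fin: "finite A" "finite M"
    and max: "\<And>S. S \<subseteq> A \<Longrightarrow> S \<noteq> {} \<Longrightarrow> \<exists>m\<in>S. \<forall>i\<in>S. R i m"
    and prod: "\<And>i i'. i \<in> A \<Longrightarrow> i' \<in> A \<Longrightarrow> R i i' \<Longrightarrow>
      (\<Sum>j\<in>M. F i j * G j i') = (if i = i' then 1 else 0)"
  shows "card A \<le> card M"
proof (rule ccontr)
  assume "\<not> card A \<le> card M"
  then obtain c where c: "\<exists>i\<in>A. c i \<noteq> 0" "\<forall>j\<in>M. (\<Sum>i\<in>A. c i * F i j) = 0"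
    using exists_nontrivial_relation[OF fin(2,1)] by (metis not_le)
  let ?S = "{i\<in>A. c i \<noteq> 0}"
  obtain m where m: "m \<in> ?S" "\<forall>i\<in>?S. R i m"
    using max[of ?S] c(1) by auto
  have "0 = (\<Sum>j\<in>M. (\<Sum>i\<in>A. c i * F i j) * G j m)"
    using c(2) by simp
  also have "\<dots> = (\<Sum>i\<in>A. c i * (\<Sum>j\<in>M. F i j * G j m))"
    by (simp add: sum_distrib_left sum_distrib_right sum.swap[of _ M A] mult.assoc)
  also have "\<dots> = (\<Sum>i\<in>A. if i = m then c i else 0)"
    by (rule sum.cong) (use m prod in auto)
  also have "\<dots> = c m"
    using m fin by simp
  finally show False
    using m by simp
qed

section \<open>Zeroth homology\<close>

lemma lookup_kscale [simp]: "Poly_Mapping.lookup (kscale a c) s = a * Poly_Mapping.lookup c s"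
  by (simp add: kscale_def Poly_Mapping.map.rep_eq when_def)

lemma kscale_simps [simp]:
  "kscale 0 c = 0" "kscale a 0 = 0" "kscale 1 c = c"
  "kscale a (kscale b c) = kscale (a * b) c"
  "kscale a (Poly_Mapping.single s b) = Poly_Mapping.single s (a * b)"
  by (auto intro!: poly_mapping_eqI simp: lookup_single when_def)

lemma kscale_add: "kscale a (c + d) = kscale a c + kscale a d"
  and kscale_add_left: "kscale (a + b) c = kscale a c + kscale b c"
  and kscale_diff: "kscale a (c - d) = kscale a c - kscale a d"
  by (auto intro!: poly_mapping_eqI simp: lookup_add lookup_minus algebra_simps)

lemma kscale_minus_one: "kscale (-1) c = - c"
  by (auto intro!: poly_mapping_eqI)

lemma kscale_sum: "kscale a (sum f S) = (\<Sum>s\<in>S. kscale a (f s))"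
  by (induction S rule: infinite_finite_induct) (auto simp: kscale_add)

lemma kextend_superset:
  assumes "finite S" "Poly_Mapping.keys c \<subseteq> S"
  shows "kextend b c = (\<Sum>s\<in>S. kscale (Poly_Mapping.lookup c s) (b s))"
  unfolding kextend_def
  by (rule sum.mono_neutral_left) (use assms in \<open>auto simp: in_keys_iff\<close>)

lemma kextend_add: "kextend b (c + d) = kextend b c + kextend b d"
proof -
  let ?S = "Poly_Mapping.keys c \<union> Poly_Mapping.keys d"
  have "kextend b (c + d) = (\<Sum>s\<in>?S. kscale (Poly_Mapping.lookup (c + d) s) (b s))"
    by (rule kextend_superset) (auto simp: Poly_Mapping.keys_add)
  then show ?thesis
    using kextend_superset[of ?S c b] kextend_superset[of ?S d b]
    by (simp add: lookup_add kscale_add_left sum.distrib)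
qed

lemma kextend_kscale: "kextend b (kscale a c) = kscale a (kextend b c)"
proof -
  have "kextend b (kscale a c) =
      (\<Sum>s\<in>Poly_Mapping.keys c. kscale (Poly_Mapping.lookup (kscale a c) s) (b s))"
    by (rule kextend_superset) (auto simp: in_keys_iff)
  then show ?thesis
    by (simp add: kextend_def kscale_sum)
qed

lemma kextend_0 [simp]: "kextend b 0 = 0"
  by (simp add: kextend_def)

lemma kextend_single [simp]: "kextend b (Poly_Mapping.single s a) = kscale a (b s)"
  by (cases "a = 0") (auto simp: kextend_def)

lemma kextend_diff: "kextend b (c - d) = kextend b c - kextend b d"
  using kextend_add[of b "c - d" d] by simp

lemma kextend_sum: "kextend b (sum f S) = (\<Sum>s\<in>S. kextend b (f s))"
  by (induction S rule: infinite_finite_induct) (auto simp: kextend_add)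

lemma kextend_kextend: "kextend b (kextend b' c) = kextend (\<lambda>s. kextend b (b' s)) c"
  unfolding kextend_def[of b' c] kextend_sum kextend_kscale by (simp add: kextend_def[of _ c])

lemma kextend_cong:
  assumes "\<And>s. s \<in> Poly_Mapping.keys c \<Longrightarrow> b s = b' s"
  shows "kextend b c = kextend b' c"
  unfolding kextend_def by (rule sum.cong) (use assms in auto)

lemma kextend_diff_fun: "kextend b c - kextend b' c = kextend (\<lambda>s. b s - b' s) c"
  by (simp add: kextend_def kscale_diff sum_subtractf)

definition ksubspace :: "('s \<Rightarrow>\<^sub>0 'k::field) set \<Rightarrow> bool" where
  "ksubspace P \<longleftrightarrow> 0 \<in> P \<and> (\<forall>c\<in>P. \<forall>d\<in>P. c + d \<in> P) \<and> (\<forall>a. \<forall>c\<in>P. kscale a c \<in> P)"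

lemma ksubspaceD:
  assumes "ksubspace P"
  shows "0 \<in> P" "c \<in> P \<Longrightarrow> d \<in> P \<Longrightarrow> c + d \<in> P" "c \<in> P \<Longrightarrow> kscale a c \<in> P"
    "c \<in> P \<Longrightarrow> - c \<in> P" "c \<in> P \<Longrightarrow> d \<in> P \<Longrightarrow> c - d \<in> P"
proof -
  show 0: "0 \<in> P" "c \<in> P \<Longrightarrow> d \<in> P \<Longrightarrow> c + d \<in> P" "c \<in> P \<Longrightarrow> kscale a c \<in> P"
    using assms by (auto simp: ksubspace_def)
  show neg: "c \<in> P \<Longrightarrow> - c \<in> P" for c
    using assms by (metis ksubspace_def kscale_minus_one)
  show "c \<in> P \<Longrightarrow> d \<in> P \<Longrightarrow> c - d \<in> P"
    using assms neg[of d] by (metis ksubspace_def diff_conv_add_uminus)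
qed

lemma ksubspace_kextend:
  assumes P: "ksubspace P" and "\<And>s. s \<in> Poly_Mapping.keys c \<Longrightarrow> b s \<in> P"
  shows "kextend b c \<in> P"
proof -
  have "(\<Sum>s\<in>S. kscale (Poly_Mapping.lookup c s) (b s)) \<in> P"
    if "finite S" "S \<subseteq> Poly_Mapping.keys c" for S
    using that by (induction S rule: finite_induct) (auto intro: ksubspaceD[OF P] assms)
  then show ?thesis
    by (simp add: kextend_def)
qed

lemma keys_kscale: "Poly_Mapping.keys (kscale a c) \<subseteq> Poly_Mapping.keys c"
  by (auto simp: in_keys_iff)

lemma ksubspace_kchains: "ksubspace (kchains p X)"
  using Poly_Mapping.keys_add keys_kscale unfolding ksubspace_def kchains_def by fastforce

lemma kboundary_add: "kboundary p (c + d) = kboundary p c + kboundary p d"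
  and kboundary_kscale: "kboundary p (kscale a c) = kscale a (kboundary p c)"
  by (auto simp: kboundary_def kextend_add kextend_kscale)

lemma ksubspace_kboundaries: "ksubspace (kboundaries p X)"
  unfolding ksubspace_def kboundaries_def
proof (intro conjI ballI allI)
  note chains = ksubspaceD[OF ksubspace_kchains]
  show "0 \<in> kboundary (Suc p) ` kchains (Suc p) X"
    using chains(1) by (force simp: kboundary_def)
  show "c + d \<in> kboundary (Suc p) ` kchains (Suc p) X"
    if "c \<in> kboundary (Suc p) ` kchains (Suc p) X" "d \<in> kboundary (Suc p) ` kchains (Suc p) X" for c d
    using that chains(2) by (auto simp: kboundary_add[symmetric] intro!: imageI)
  show "kscale a c \<in> kboundary (Suc p) ` kchains (Suc p) X"
    if "c \<in> kboundary (Suc p) ` kchains (Suc p) X" for a c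
    using that chains(3) by (auto simp: kboundary_kscale[symmetric] intro!: imageI)
qed

lemmas kboundaries_closed = ksubspaceD[OF ksubspace_kboundaries]
lemmas kchains_closed = ksubspaceD[OF ksubspace_kchains]

section \<open>Points, paths and boundaries in degree zero\<close>

definition origin0 :: "nat \<Rightarrow> real" where "origin0 = (\<lambda>j. if j = 0 then 1 else 0)"

text \<open>Singular simplices are extensional, hence the restriction. Points correspond to
  0-simplices through this map and evaluation at \<open>origin0\<close>.\<close>

definition const_simplex :: "'a \<Rightarrow> (nat \<Rightarrow> real) \<Rightarrow> 'a" where
  "const_simplex x = (\<lambda>v\<in>standard_simplex 0. x)"

lemma standard_simplex_0': "standard_simplex 0 = {origin0}"
  by (simp add: standard_simplex_0 origin0_def)

lemma const_simplex_origin [simp]: "const_simplex x origin0 = x"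
  by (simp add: const_simplex_def standard_simplex_0')

lemma singular_simplex_0_iff:
  "singular_simplex 0 X s \<longleftrightarrow> s = const_simplex (s origin0) \<and> s origin0 \<in> topspace X"
proof
  assume s: "singular_simplex 0 X s"
  then have "s \<in> extensional {origin0}" "s ` {origin0} \<subseteq> topspace X"
    using continuous_map_image_subset_topspace
    by (fastforce simp: singular_simplex_def standard_simplex_0')+
  then show "s = const_simplex (s origin0) \<and> s origin0 \<in> topspace X"
    by (auto simp: const_simplex_def standard_simplex_0' extensional_def)
next
  assume s: "s = const_simplex (s origin0) \<and> s origin0 \<in> topspace X"
  have "continuous_map (subtopology (powertop_real UNIV) (standard_simplex 0)) X s"
    by (rule continuous_map_eq[where f = "\<lambda>_. s origin0"])
      (use s in \<open>auto simp: standard_simplex_0'\<close>)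
  moreover have "s \<in> extensional (standard_simplex 0)"
    using s unfolding const_simplex_def by (metis restrict_extensional)
  ultimately show "singular_simplex 0 X s"
    by (simp add: singular_simplex_def)
qed

lemma singular_simplex_const: "x \<in> topspace X \<Longrightarrow> singular_simplex 0 X (const_simplex x)"
  by (simp add: singular_simplex_0_iff)

lemma origin_in_topspace: "c \<in> kchains 0 X \<Longrightarrow> s \<in> Poly_Mapping.keys c \<Longrightarrow> s origin0 \<in> topspace X"
  and const_simplex_keys: "c \<in> kchains 0 X \<Longrightarrow> s \<in> Poly_Mapping.keys c \<Longrightarrow> const_simplex (s origin0) = s"
  by (auto simp: kchains_def singular_simplex_0_iff)

lemma kboundary_single_1:
  "kboundary (Suc 0) (Poly_Mapping.single \<tau> 1) =
    Poly_Mapping.single (singular_face (Suc 0) 0 \<tau>) 1 -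
    Poly_Mapping.single (singular_face (Suc 0) (Suc 0) \<tau>) 1"
  by (simp add: kboundary_def single_uminus)

lemma singular_face_1: "k \<le> 1 \<Longrightarrow>
    singular_face (Suc 0) k \<tau> = const_simplex (\<tau> (simplical_face k origin0))"
  by (auto simp: singular_face_def const_simplex_def standard_simplex_0' restrict_def)

lemma path_component_imp_kboundary:
  assumes "path_component_of X x y"
  shows "Poly_Mapping.single (const_simplex x) 1 - Poly_Mapping.single (const_simplex y) (1::'k::field)
    \<in> kboundaries 0 X"
proof -
  obtain g where g: "pathin X g" "g 0 = x" "g 1 = y"
    using assms by (auto simp: path_component_of_def)
  \<comment> \<open>The path is run along barycentric coordinate 0. This coordinate is 0 on face 0
    and 1 on face 1, so the boundary is \<open>x\<close> minus \<open>y\<close> with the required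
    sign.\<close>
  define \<tau> where "\<tau> = restrict (\<lambda>v. g (v 0)) (standard_simplex (Suc 0))"
  have "continuous_map (subtopology (powertop_real UNIV) (standard_simplex (Suc 0)))
      (top_of_set {0..1}) (\<lambda>v. v 0)"
    by (auto simp: continuous_map_in_subtopology standard_simplex_def
        intro: continuous_map_from_subtopology continuous_map_product_projection)
  then have "continuous_map (subtopology (powertop_real UNIV) (standard_simplex (Suc 0))) X (g \<circ> (\<lambda>v. v 0))"
    using g(1) unfolding pathin_def by (rule continuous_map_compose)
  then have "continuous_map (subtopology (powertop_real UNIV) (standard_simplex (Suc 0))) X \<tau>"
    by (rule continuous_map_eq) (auto simp: \<tau>_def)
  then have "singular_simplex (Suc 0) X \<tau>"
    by (simp add: singular_simplex_def \<tau>_def)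
  then have "Poly_Mapping.single \<tau> 1 \<in> kchains (Suc 0) X"
    by (simp add: kchains_def)
  then have bd: "kboundary (Suc 0) (Poly_Mapping.single \<tau> (1::'k)) \<in> kboundaries 0 X"
    unfolding kboundaries_def by blast
  have "simplical_face 0 origin0 \<in> standard_simplex (Suc 0)"
    "simplical_face (Suc 0) origin0 \<in> standard_simplex (Suc 0)"
    by (rule simplical_face_in_standard_simplex; simp add: standard_simplex_0')+
  then have "\<tau> (simplical_face 0 origin0) = x" "\<tau> (simplical_face (Suc 0) origin0) = y"
    using g by (simp_all add: \<tau>_def simplical_face_def origin0_def)
  then show ?thesis
    using bd unfolding kboundary_single_1 by (simp add: singular_face_1)
qed

lemma path_component_of_faces:
  assumes "singular_simplex (Suc 0) X \<tau>"
  shows "path_component_of X (\<tau> (simplical_face 0 origin0)) (\<tau> (simplical_face (Suc 0) origin0))"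
proof -
  have "path_connectedin (subtopology (powertop_real UNIV) (standard_simplex (Suc 0)))
      (standard_simplex (Suc 0))"
    using path_connectedin_standard_simplex by (simp add: path_connectedin_subtopology)
  then have "path_connectedin X (\<tau> ` standard_simplex (Suc 0))"
    using assms path_connectedin_continuous_map_image unfolding singular_simplex_def by blast
  moreover have "simplical_face 0 origin0 \<in> standard_simplex (Suc 0)"
    "simplical_face (Suc 0) origin0 \<in> standard_simplex (Suc 0)"
    by (rule simplical_face_in_standard_simplex; simp add: standard_simplex_0')+
  ultimately show ?thesis
    unfolding path_component_of by blast
qed

section \<open>Maps of 0-chains induced by maps of points\<close>

definition push :: "('a \<Rightarrow> 'b) \<Rightarrow> ('a, 'k::field) kchain \<Rightarrow> ('b, 'k) kchain" where
  "push r z = kextend (\<lambda>s. Poly_Mapping.single (const_simplex (r (s origin0))) 1) z"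

lemma push_add: "push r (c + d) = push r c + push r d"
  and push_kscale: "push r (kscale a c) = kscale a (push r c)"
  by (auto simp: push_def kextend_add kextend_kscale)

lemma push_in_kchains:
  assumes "r \<in> topspace X \<rightarrow> topspace Y" "z \<in> kchains 0 X"
  shows "push r z \<in> kchains 0 Y"
  unfolding push_def
proof (rule ksubspace_kextend[OF ksubspace_kchains])
  fix s
  assume "s \<in> Poly_Mapping.keys z"
  then have "s origin0 \<in> topspace X"
    using assms(2) by (rule origin_in_topspace[rotated])
  then show "Poly_Mapping.single (const_simplex (r (s origin0))) 1 \<in> kchains 0 Y"
    using assms(1) singular_simplex_const by (fastforce simp: kchains_def)
qed

text \<open>Takes the place of continuity, because the point maps obtained from a Reeb graph
  interleaving are arbitrary choices. The case \<open>x = y\<close> says that points of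
  \<open>X\<close> go to points of \<open>Y\<close>.\<close>

definition preserves_components :: "'a topology \<Rightarrow> 'b topology \<Rightarrow> ('a \<Rightarrow> 'b) \<Rightarrow> bool" where
  "preserves_components X Y r \<longleftrightarrow>
     (\<forall>x y. path_component_of X x y \<longrightarrow> path_component_of Y (r x) (r y))"

lemma preserves_components_topspace:
  assumes "preserves_components X Y r"
  shows "r \<in> topspace X \<rightarrow> topspace Y"
  using assms by (auto simp: preserves_components_def simp flip: path_component_of_refl)

text \<open>The end points of a singular 1-simplex lie in one path component, hence so do their
  images, and points of one component differ by a boundary. The 1-simplex itself is never
  mapped.\<close>

lemma push_in_kboundaries:
  assumes r: "preserves_components X Y r" and b: "b \<in> kboundaries 0 X"
  shows "push r b \<in> kboundaries 0 Y"
proof -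
  obtain c where c: "c \<in> kchains (Suc 0) X" "b = kboundary (Suc 0) c"
    using b by (auto simp: kboundaries_def)
  have "push r b = kextend (\<lambda>s. kextend (\<lambda>s. Poly_Mapping.single (const_simplex (r (s origin0))) 1)
      (Poly_Mapping.single (singular_face (Suc 0) 0 s) 1 +
       Poly_Mapping.single (singular_face (Suc 0) (Suc 0) s) (- 1))) c"
    unfolding push_def c(2) by (simp add: kboundary_def kextend_kextend)
  also have "\<dots> \<in> kboundaries 0 Y"
  proof (rule ksubspace_kextend[OF ksubspace_kboundaries])
    fix s
    assume "s \<in> Poly_Mapping.keys c"
    then have "singular_simplex (Suc 0) X s"
      using c(1) by (auto simp: kchains_def)
    then have "path_component_of Y (r (s (simplical_face 0 origin0))) (r (s (simplical_face (Suc 0) origin0)))"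
      using path_component_of_faces r unfolding preserves_components_def by blast
    from path_component_imp_kboundary[OF this]
    show "kextend (\<lambda>s. Poly_Mapping.single (const_simplex (r (s origin0))) 1)
      (Poly_Mapping.single (singular_face (Suc 0) 0 s) 1 +
       Poly_Mapping.single (singular_face (Suc 0) (Suc 0) s) (- 1)) \<in> kboundaries 0 Y"
      by (simp add: kextend_diff singular_face_1 single_uminus)
  qed
  finally show ?thesis .
qed

text \<open>The paths from \<open>r x\<close> to \<open>r' x\<close> may be chosen separately for
  each \<open>x\<close>, since a 0-chain only sees points. This makes homology independent of all
  later choices.\<close>

lemma push_homologous:
  assumes "\<And>x. x \<in> topspace X \<Longrightarrow> path_component_of Y (r x) (r' x)" and "z \<in> kchains 0 X"
  shows "push r z - push r' z \<in> kboundaries 0 Y"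
  unfolding push_def kextend_diff_fun
proof (rule ksubspace_kextend[OF ksubspace_kboundaries])
  fix s
  assume "s \<in> Poly_Mapping.keys z"
  then have "s origin0 \<in> topspace X"
    using assms(2) by (rule origin_in_topspace[rotated])
  then show "Poly_Mapping.single (const_simplex (r (s origin0))) 1 -
      Poly_Mapping.single (const_simplex (r' (s origin0))) 1 \<in> kboundaries 0 Y"
    by (intro path_component_imp_kboundary assms(1))
qed

lemma push_push: "push r' (push r z) = push (r' \<circ> r) z"
  by (simp add: push_def kextend_kextend)

lemma push_id:
  assumes "z \<in> kchains 0 X"
  shows "push (\<lambda>x. x) z = z"
proof -
  have "push (\<lambda>x. x) z = kextend (\<lambda>s. Poly_Mapping.single s 1) z"
    unfolding push_def by (rule kextend_cong) (use assms const_simplex_keys in fastforce)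
  also have "\<dots> = z"
    by (rule poly_mapping_eqI) (auto simp: kextend_def lookup_sum lookup_single when_def in_keys_iff)
  finally show ?thesis .
qed

definition hclass :: "'a topology \<Rightarrow> ('a, 'k::field) kchain \<Rightarrow> ('a, 'k) kchain set" where
  "hclass X z = {z + b | b. b \<in> kboundaries 0 X}"

lemma hclass_eqI:
  assumes "z - z' \<in> kboundaries 0 X"
  shows "hclass X z = hclass X z'"
proof -
  have "z + b = z' + ((z - z') + b)" "z' + b = z + (b - (z - z'))" for b
    by simp_all
  then show ?thesis
    unfolding hclass_def using assms kboundaries_closed(2,5) by blast
qed

lemma carrier_khomology: "carrier (khomology 0 X) = hclass X ` kchains 0 X"
  by (auto simp: khomology_def hclass_def kcycles_def kboundary_def)

lemma zero_khomology: "\<zero>\<^bsub>khomology 0 X\<^esub> = hclass X 0"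
  by (auto simp: khomology_def hclass_def)

lemma add_khomology: "hclass X c \<oplus>\<^bsub>khomology 0 X\<^esub> hclass X d = hclass X (c + d)"
proof -
  have "\<exists>b. c + b1 + (d + b2) = c + d + b \<and> b \<in> kboundaries 0 X"
    if "b1 \<in> kboundaries 0 X" "b2 \<in> kboundaries 0 X" for b1 b2
    using that kboundaries_closed(2) by (intro exI[of _ "b1 + b2"]) (auto simp: algebra_simps)
  moreover have "\<exists>c' d'. c + d + b = c' + d' \<and> (\<exists>b. c' = c + b \<and> b \<in> kboundaries 0 X) \<and>
      (\<exists>b. d' = d + b \<and> b \<in> kboundaries 0 X)" if "b \<in> kboundaries 0 X" for b
    using that kboundaries_closed(1)
    by (intro exI[of _ "c + b"] exI[of _ "d"]) (force simp: algebra_simps)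
  ultimately show ?thesis
    by (auto simp: khomology_def hclass_def)
qed

lemma smult_khomology: "a \<odot>\<^bsub>khomology 0 X\<^esub> hclass X c = hclass X (kscale a c)"
proof -
  have "(\<exists>c' b2. x = kscale a c' + b2 \<and> (\<exists>b1. c' = c + b1 \<and> b1 \<in> kboundaries 0 X) \<and>
      b2 \<in> kboundaries 0 X) \<longleftrightarrow> (\<exists>b. x = kscale a c + b \<and> b \<in> kboundaries 0 X)" (is "?l \<longleftrightarrow> ?r") for x
  proof
    assume ?l
    then obtain b1 b2 where "x = kscale a (c + b1) + b2" "b1 \<in> kboundaries 0 X" "b2 \<in> kboundaries 0 X"
      by blast
    then show ?r
      by (intro exI[of _ "kscale a b1 + b2"])
        (auto simp: kscale_add add.assoc intro: kboundaries_closed(2,3))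
  next
    assume ?r
    then show ?l
      using kboundaries_closed(1) by (metis add.right_neutral)
  qed
  then show ?thesis
    by (auto simp: khomology_def hclass_def)
qed

lemma abelian_monoid_khomology: "abelian_monoid (khomology 0 X)"
proof (rule abelian_monoidI)
  show "\<zero>\<^bsub>khomology 0 X\<^esub> \<in> carrier (khomology 0 X)"
    using kchains_closed(1) by (auto simp: carrier_khomology zero_khomology)
qed (use kchains_closed(2) in
    \<open>auto simp: carrier_khomology zero_khomology add_khomology ac_simps intro!: imageI\<close>)

lemma smult_closed_khomology:
  "x \<in> carrier (khomology 0 X) \<Longrightarrow> a \<odot>\<^bsub>khomology 0 X\<^esub> x \<in> carrier (khomology 0 X)"
  using kchains_closed(3) by (auto simp: carrier_khomology smult_khomology intro!: imageI)

text \<open>The image of a coset under \<open>push\<close> need not be a full coset, so the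
  boundaries of the target are added, as in \<open>khomology_map\<close>.\<close>

definition hmap :: "('a \<Rightarrow> 'b) \<Rightarrow> 'b topology \<Rightarrow> ('a, 'k::field) kchain set \<Rightarrow> ('b, 'k) kchain set" where
  "hmap r Y C = {push r z + b | z b. z \<in> C \<and> b \<in> kboundaries 0 Y}"

lemma hmap_hclass:
  assumes "preserves_components X Y r"
  shows "hmap r Y (hclass X z) = hclass Y (push r z)"
proof -
  have "(\<exists>c' b2. x = push r c' + b2 \<and> (\<exists>b1. c' = z + b1 \<and> b1 \<in> kboundaries 0 X) \<and>
      b2 \<in> kboundaries 0 Y) \<longleftrightarrow> (\<exists>b. x = push r z + b \<and> b \<in> kboundaries 0 Y)" (is "?l \<longleftrightarrow> ?r") for x
  proof
    assume ?l
    then obtain b1 b2 where "x = push r (z + b1) + b2" "b1 \<in> kboundaries 0 X" "b2 \<in> kboundaries 0 Y"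
      by blast
    then show ?r
      by (intro exI[of _ "push r b1 + b2"])
        (auto simp: push_add add.assoc intro: kboundaries_closed(2) push_in_kboundaries[OF assms])
  next
    assume ?r
    then show ?l
      using kboundaries_closed(1) by (metis add.right_neutral)
  qed
  then show ?thesis
    by (auto simp: hmap_def hclass_def)
qed

lemma linear_hmap:
  assumes "preserves_components X Y r"
  shows "linear_map_between (khomology 0 X) (khomology 0 Y) (hmap r Y)"
  unfolding linear_map_between_def
  using push_in_kchains[OF preserves_components_topspace[OF assms]]
  by (auto simp: carrier_khomology add_khomology smult_khomology hmap_hclass[OF assms]
      push_add push_kscale intro!: imageI)

text \<open>Links the internal maps of the interlevel modules to \<open>push\<close>: on
  0-simplices, \<open>simplex_map\<close> of the identity is \<open>const_simplex\<close> of the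
  evaluation.\<close>

lemma khomology_map_inclusion:
  assumes "z \<in> kchains 0 X" and "preserves_components X Y (\<lambda>x. x)"
  shows "khomology_map 0 (\<lambda>x. x) Y (hclass X z) = hclass Y z"
proof -
  have "kextend (\<lambda>s. Poly_Mapping.single (simplex_map 0 (\<lambda>x. x) s) 1) c = push (\<lambda>x. x) c"
    for c :: "('a, 'b) kchain"
    unfolding push_def
    by (rule kextend_cong) (auto simp: simplex_map_def const_simplex_def standard_simplex_0'
        intro!: arg_cong[where f = "\<lambda>s. Poly_Mapping.single s 1"])
  then have "khomology_map 0 (\<lambda>x. x) Y (hclass X z) = hmap (\<lambda>x. x) Y (hclass X z)"
    by (simp add: khomology_map_def hmap_def)
  then show ?thesis
    using assms by (simp add: hmap_hclass push_id)
qed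

section \<open>From Reeb graph interleavings to homology\<close>

lemma path_components_of_eqI:
  assumes "D \<in> path_components_of X" "y \<in> D"
  shows "D = path_component_of_set X y"
proof -
  obtain x where x: "D = path_component_of_set X x"
    using assms(1) by (auto simp: path_components_of_def)
  then have "path_component_of X x y"
    using assms(2) by simp
  then have "path_component_of X x = path_component_of X y"
    by (simp only: path_component_of_equiv)
  then show ?thesis
    using x by simp
qed

lemma path_component_of_if_same_component:
  assumes "path_component_of_set X a = path_component_of_set X b" "a \<in> topspace X"
  shows "path_component_of X a b"
proof -
  have "a \<in> path_component_of_set X b"
    unfolding assms(1)[symmetric] using assms(2) by (simp add: path_component_of_refl)
  then have "path_component_of X b a"
    by simp
  then show ?thesis
    by (rule path_component_of_sym)
qed

lemma interlevel_mono:
  assumes "le_oprr p q"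
  shows "preserves_components (interlevel X \<gamma> p) (interlevel X \<gamma> q) (\<lambda>x. x)"
proof -
  have "{x \<in> topspace X. \<gamma> x \<in> {fst p..snd p}} \<subseteq> {x \<in> topspace X. \<gamma> x \<in> {fst q..snd q}}"
    using assms by (auto simp: le_oprr_def)
  then show ?thesis
    unfolding preserves_components_def interlevel_def preimage_space_def
    using path_component_of_mono[of X] by (intro allI impI) simp
qed

text \<open>Resolves the definite description: a path component of the larger space that contains
  \<open>?C\<close> passes through \<open>x\<close>, and this determines it.\<close>

lemma reeb_functor_map:
  assumes "le_oprr p q" and x: "x \<in> topspace (interlevel X \<gamma> p)"
  shows "set_map (reeb_functor X \<gamma>) p q (path_component_of_set (interlevel X \<gamma> p) x) =
    path_component_of_set (interlevel X \<gamma> q) x"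
proof -
  let ?C = "path_component_of_set (interlevel X \<gamma> p) x"
    and ?D = "path_component_of_set (interlevel X \<gamma> q) x"
  have xC: "x \<in> ?C"
    using x by (simp add: path_component_of_refl)
  have CD: "?C \<subseteq> ?D"
    using interlevel_mono[OF assms(1), of X \<gamma>] by (auto simp: preserves_components_def)
  have "x \<in> topspace (interlevel X \<gamma> q)"
    by (rule subsetD[OF path_component_of_subset_topspace subsetD[OF CD xC]])
  then have D: "?D \<in> path_components_of (interlevel X \<gamma> q)"
    by (simp add: path_component_in_path_components_of)
  have "(THE D. D \<in> path_components_of (interlevel X \<gamma> q) \<and> ?C \<subseteq> D) = ?D"
  proof (rule the_equality)
    show "?D \<in> path_components_of (interlevel X \<gamma> q) \<and> ?C \<subseteq> ?D"
      using D CD by (rule conjI)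
  next
    fix D
    assume "D \<in> path_components_of (interlevel X \<gamma> q) \<and> ?C \<subseteq> D"
    then show "D = ?D"
      using xC by (intro path_components_of_eqI) (simp, fastforce)
  qed
  then show ?thesis
    by (simp add: reeb_functor_def)
qed

lemma le_oprr_shift2: "le_oprr p q \<Longrightarrow> le_oprr (shift2 \<epsilon> p) (shift2 \<epsilon> q)"
  by (auto simp: le_oprr_def shift2_def)

lemma shift2_in_upper_half: "0 \<le> \<epsilon> \<Longrightarrow> p \<in> upper_half \<Longrightarrow> shift2 \<epsilon> p \<in> upper_half"
  by (auto simp: upper_half_def shift2_def)

lemma shift2_shift2: "shift2 \<epsilon> (shift2 \<epsilon> p) = shift2 (2 * \<epsilon>) p"
  by (simp add: shift2_def)

lemma le_oprr_shift2_self: "0 \<le> \<epsilon> \<Longrightarrow> le_oprr p (shift2 \<epsilon> p)"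
  by (auto simp: le_oprr_def shift2_def)

text \<open>Naturality is stated on the half plane only, where the interlevel modules live; for a
  nonnegative shift the target indices stay there.\<close>

definition shifted_morphism ::
  "real \<Rightarrow> (real \<times> real, 'k, 'v) vec_diagram \<Rightarrow> (real \<times> real, 'k, 'w) vec_diagram
    \<Rightarrow> (real \<times> real \<Rightarrow> 'v \<Rightarrow> 'w) \<Rightarrow> bool" where
  "shifted_morphism \<epsilon> M N f \<longleftrightarrow>
     (\<forall>p\<in>upper_half. linear_map_between (vec_at M p) (vec_at N (shift2 \<epsilon> p)) (f p)) \<and>
     (\<forall>p\<in>upper_half. \<forall>q\<in>upper_half. le_oprr p q \<longrightarrow>
        (\<forall>x\<in>carrier (vec_at M p).
           f q (vec_map M p q x) = vec_map N (shift2 \<epsilon> p) (shift2 \<epsilon> q) (f p x)))"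

text \<open>The choice depends on \<open>x\<close> only through its path component. It need not be
  continuous, and choices at different \<open>p\<close> are unrelated.\<close>

definition component_point ::
  "(real \<times> real \<Rightarrow> 'a set \<Rightarrow> 'b set) \<Rightarrow> 'a topology \<Rightarrow> ('a \<Rightarrow> real) \<Rightarrow> real \<times> real \<Rightarrow> 'a \<Rightarrow> 'b" where
  "component_point f X \<gamma> p x = (SOME y. y \<in> f p (path_component_of_set (interlevel X \<gamma> p) x))"

locale reeb_map =
  fixes \<epsilon> :: real and X :: "'a topology" and \<gamma> :: "'a \<Rightarrow> real"
    and Y :: "'b topology" and \<kappa> :: "'b \<Rightarrow> real" and f :: "real \<times> real \<Rightarrow> 'a set \<Rightarrow> 'b set"
  assumes eps: "0 \<le> \<epsilon>"
    and nat: "set_nat_trans UNIV le_oprr (reeb_functor X \<gamma>)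
      (set_diagram_shift \<epsilon> (reeb_functor Y \<kappa>)) f"
begin

abbreviation "r \<equiv> component_point f X \<gamma>"

lemma component_image:
  assumes p: "p \<in> upper_half" and x: "x \<in> topspace (interlevel X \<gamma> p)"
  shows "r p x \<in> topspace (interlevel Y \<kappa> (shift2 \<epsilon> p))"
    and "f p (path_component_of_set (interlevel X \<gamma> p) x) =
      path_component_of_set (interlevel Y \<kappa> (shift2 \<epsilon> p)) (r p x)"
proof -
  let ?C = "path_component_of_set (interlevel X \<gamma> p) x"
  have "?C \<in> set_at (reeb_functor X \<gamma>) p"
    using assms by (simp add: reeb_functor_def path_component_in_path_components_of)
  then have "f p ?C \<in> set_at (set_diagram_shift \<epsilon> (reeb_functor Y \<kappa>)) p"
    using nat unfolding set_nat_trans_def by blast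
  then have D: "f p ?C \<in> path_components_of (interlevel Y \<kappa> (shift2 \<epsilon> p))"
    using shift2_in_upper_half[OF eps p] by (simp add: set_diagram_shift_def reeb_functor_def)
  then obtain y where "y \<in> f p ?C"
    using nonempty_path_components_of by fastforce
  then have r: "r p x \<in> f p ?C"
    unfolding component_point_def by (rule someI)
  show "r p x \<in> topspace (interlevel Y \<kappa> (shift2 \<epsilon> p))"
    using path_components_of_subset[OF D] r by blast
  show "f p ?C = path_component_of_set (interlevel Y \<kappa> (shift2 \<epsilon> p)) (r p x)"
    using path_components_of_eqI[OF D r] .
qed

lemma preserves_components_point:
  assumes p: "p \<in> upper_half"
  shows "preserves_components (interlevel X \<gamma> p) (interlevel Y \<kappa> (shift2 \<epsilon> p)) (r p)"
  unfolding preserves_components_def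
proof (intro allI impI)
  fix x y
  assume xy: "path_component_of (interlevel X \<gamma> p) x y"
  then have "path_component_of_set (interlevel X \<gamma> p) x = path_component_of_set (interlevel X \<gamma> p) y"
    and x: "x \<in> topspace (interlevel X \<gamma> p)"
    by (auto simp: path_component_of_equiv)
  then have "r p x = r p y"
    by (simp add: component_point_def)
  then show "path_component_of (interlevel Y \<kappa> (shift2 \<epsilon> p)) (r p x) (r p y)"
    using component_image(1)[OF p x] by (simp add: path_component_of_refl)
qed

text \<open>The points chosen at \<open>p\<close> and \<open>q\<close> agree only up to a path in
  the larger interlevel set; by \<open>push_homologous\<close> this suffices in homology.\<close>

lemma point_natural:
  assumes p: "p \<in> upper_half" and q: "q \<in> upper_half" and le: "le_oprr p q"
    and x: "x \<in> topspace (interlevel X \<gamma> p)"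
  shows "path_component_of (interlevel Y \<kappa> (shift2 \<epsilon> q)) (r q x) (r p x)"
proof -
  let ?C = "path_component_of_set (interlevel X \<gamma> p) x"
  have x': "x \<in> topspace (interlevel X \<gamma> q)"
    using preserves_components_topspace[OF interlevel_mono[OF le, of X \<gamma>]] x by blast
  have "?C \<in> set_at (reeb_functor X \<gamma>) p"
    using p x by (simp add: reeb_functor_def path_component_in_path_components_of)
  then have "f q (set_map (reeb_functor X \<gamma>) p q ?C) =
      set_map (set_diagram_shift \<epsilon> (reeb_functor Y \<kappa>)) p q (f p ?C)"
    using nat le unfolding set_nat_trans_def by blast
  then have "path_component_of_set (interlevel Y \<kappa> (shift2 \<epsilon> q)) (r q x) =
      path_component_of_set (interlevel Y \<kappa> (shift2 \<epsilon> q)) (r p x)"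
    using component_image[OF p x] component_image[OF q x'] le_oprr_shift2[OF le]
    by (simp add: reeb_functor_map[OF le x] set_diagram_shift_def reeb_functor_map)
  then show ?thesis
    using component_image(1)[OF q x'] by (rule path_component_of_if_same_component)
qed

definition homology_map :: "real \<times> real \<Rightarrow> ('a, 'k::field) kchain set \<Rightarrow> ('b, 'k) kchain set" where
  "homology_map p = hmap (r p) (interlevel Y \<kappa> (shift2 \<epsilon> p))"

lemma homology_map_hclass:
  assumes "p \<in> upper_half"
  shows "homology_map p (hclass (interlevel X \<gamma> p) z) =
    hclass (interlevel Y \<kappa> (shift2 \<epsilon> p)) (push (r p) z)"
  unfolding homology_map_def by (rule hmap_hclass[OF preserves_components_point[OF assms]])

lemma push_point_in_kchains:
  assumes "p \<in> upper_half" "z \<in> kchains 0 (interlevel X \<gamma> p)"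
  shows "push (r p) z \<in> kchains 0 (interlevel Y \<kappa> (shift2 \<epsilon> p))"
  using assms(2) by (rule push_in_kchains
    [OF preserves_components_topspace[OF preserves_components_point[OF assms(1)]]])

lemma shifted_morphism_homology:
  "shifted_morphism \<epsilon>
    (interlevel_homology 0 X \<gamma> :: (real \<times> real, 'k::field, ('a, 'k) kchain set) vec_diagram)
    (interlevel_homology 0 Y \<kappa>) homology_map"
  unfolding shifted_morphism_def
proof (intro conjI ballI impI)
  fix p :: "real \<times> real"
  assume p: "p \<in> upper_half"
  show "linear_map_between
      (vec_at (interlevel_homology 0 X \<gamma> :: (real \<times> real, 'k, ('a, 'k) kchain set) vec_diagram) p)
      (vec_at (interlevel_homology 0 Y \<kappa>) (shift2 \<epsilon> p)) (homology_map p)"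
    using linear_hmap[OF preserves_components_point[OF p]]
    by (simp add: interlevel_homology_def homology_map_def)
next
  fix p q and x
  assume p: "p \<in> upper_half" and q: "q \<in> upper_half" and le: "le_oprr p q"
    and "x \<in> carrier (vec_at
      (interlevel_homology 0 X \<gamma> :: (real \<times> real, 'k, ('a, 'k) kchain set) vec_diagram) p)"
  then obtain z where z: "z \<in> kchains 0 (interlevel X \<gamma> p)" "x = hclass (interlevel X \<gamma> p) z"
    by (auto simp: interlevel_homology_def carrier_khomology)
  have "homology_map q (khomology_map 0 (\<lambda>x. x) (interlevel X \<gamma> q) x) =
      hclass (interlevel Y \<kappa> (shift2 \<epsilon> q)) (push (r q) z)"
    using khomology_map_inclusion[OF z(1) interlevel_mono[OF le]]
    by (simp add: z(2) homology_map_hclass[OF q])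
  also have "\<dots> = hclass (interlevel Y \<kappa> (shift2 \<epsilon> q)) (push (r p) z)"
    by (rule hclass_eqI, rule push_homologous[OF _ z(1)]) (rule point_natural[OF p q le])
  also have "\<dots> = khomology_map 0 (\<lambda>x. x) (interlevel Y \<kappa> (shift2 \<epsilon> q)) (homology_map p x)"
    using khomology_map_inclusion[OF push_point_in_kchains[OF p z(1)]
        interlevel_mono[OF le_oprr_shift2[OF le]]]
    by (simp add: z(2) homology_map_hclass[OF p])
  finally show "homology_map q (vec_map (interlevel_homology 0 X \<gamma>) p q x) =
      vec_map (interlevel_homology 0 Y \<kappa>) (shift2 \<epsilon> p) (shift2 \<epsilon> q) (homology_map p x)"
    by (simp add: interlevel_homology_def)
qed

end

text \<open>The composite of the two choices returns \<open>x\<close> up to a path in the interlevel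
  set widened by \<open>2 * \<epsilon>\<close>. With one order of the two maps fixed, both
  interleaving identities are instances.\<close>

lemma homology_map_comp:
  assumes f: "reeb_map \<epsilon> X \<gamma> Y \<kappa> f" and g: "reeb_map \<epsilon> Y \<kappa> X \<gamma> g"
    and comp: "\<And>p x. x \<in> set_at (reeb_functor X \<gamma>) p \<Longrightarrow>
      g (shift2 \<epsilon> p) (f p x) = set_map (reeb_functor X \<gamma>) p (shift2 (2 * \<epsilon>) p) x"
    and p: "p \<in> upper_half"
    and x: "x \<in> carrier (vec_at (interlevel_homology 0 X \<gamma>
      :: (real \<times> real, 'k::field, ('a, 'k) kchain set) vec_diagram) p)"
  shows "reeb_map.homology_map \<epsilon> Y \<kappa> X \<gamma> g (shift2 \<epsilon> p) (reeb_map.homology_map \<epsilon> X \<gamma> Y \<kappa> f p x) =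
    vec_map (interlevel_homology 0 X \<gamma>) p (shift2 (2 * \<epsilon>) p) x"
proof -
  interpret f: reeb_map \<epsilon> X \<gamma> Y \<kappa> f by fact
  interpret g: reeb_map \<epsilon> Y \<kappa> X \<gamma> g by fact
  note p' = shift2_in_upper_half[OF f.eps p]
  have le: "le_oprr p (shift2 (2 * \<epsilon>) p)"
    using f.eps by (simp add: le_oprr_shift2_self)
  obtain z where z: "z \<in> kchains 0 (interlevel X \<gamma> p)" "x = hclass (interlevel X \<gamma> p) z"
    using x by (auto simp: interlevel_homology_def carrier_khomology)
  have "path_component_of (interlevel X \<gamma> (shift2 (2 * \<epsilon>) p)) ((g.r (shift2 \<epsilon> p) \<circ> f.r p) x) x"
    if x: "x \<in> topspace (interlevel X \<gamma> p)" for x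
  proof -
    let ?C = "path_component_of_set (interlevel X \<gamma> p) x"
    note y = f.component_image[OF p x]
    note w = g.component_image[OF p' y(1)]
    have "?C \<in> set_at (reeb_functor X \<gamma>) p"
      using p x by (simp add: reeb_functor_def path_component_in_path_components_of)
    then have "g (shift2 \<epsilon> p) (f p ?C) = path_component_of_set (interlevel X \<gamma> (shift2 (2 * \<epsilon>) p)) x"
      using comp reeb_functor_map[OF le x] by simp
    then have "path_component_of_set (interlevel X \<gamma> (shift2 (2 * \<epsilon>) p)) ((g.r (shift2 \<epsilon> p) \<circ> f.r p) x) =
        path_component_of_set (interlevel X \<gamma> (shift2 (2 * \<epsilon>) p)) x"
      by (simp add: y(2) w(2) shift2_shift2)
    then show ?thesis
      by (rule path_component_of_if_same_component) (use w(1) in \<open>simp add: shift2_shift2\<close>)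
  qed
  then have "hclass (interlevel X \<gamma> (shift2 (2 * \<epsilon>) p)) (push (g.r (shift2 \<epsilon> p) \<circ> f.r p) z) =
      hclass (interlevel X \<gamma> (shift2 (2 * \<epsilon>) p)) (push (\<lambda>x. x) z)"
    by (intro hclass_eqI push_homologous[OF _ z(1)])
  then show ?thesis
    using khomology_map_inclusion[OF z(1) interlevel_mono[OF le]]
    by (simp add: z(2) f.homology_map_hclass[OF p] g.homology_map_hclass[OF p'] push_push
        push_id[OF z(1)] shift2_shift2 interlevel_homology_def)
qed

section \<open>Blocks\<close>

text \<open>\<open>left_open\<close> and \<open>right_closed\<close> bound the coordinate
  \<open>x\<close>, the other two bound \<open>y\<close>. In this form all kinds of blocks are
  treated at once.\<close>

record block_ends =
  left_open :: ereal
  right_closed :: ereal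
  left_closed :: ereal
  right_open :: ereal

text \<open>
  Each end of a block is closed, open or infinite; the bounds that do not apply are infinite.
  An infinite end is thus regarded as a kind of its own.
\<close>

definition admissible_ends :: "block_ends \<Rightarrow> bool" where
  "admissible_ends e \<longleftrightarrow>
     left_open e \<noteq> \<infinity> \<and> left_closed e \<noteq> \<infinity> \<and> right_closed e \<noteq> - \<infinity> \<and> right_open e \<noteq> - \<infinity> \<and>
     (left_open e = - \<infinity> \<or> left_closed e = - \<infinity>) \<and> (right_closed e = \<infinity> \<or> right_open e = \<infinity>)"

definition block_of :: "block_ends \<Rightarrow> (real \<times> real) set" where
  "block_of e = {(x, y) \<in> upper_half. left_open e < ereal x \<and> ereal x \<le> right_closed e \<and>
     left_closed e \<le> ereal y \<and> ereal y < right_open e}"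

lemma is_block_ends:
  assumes "is_block J"
  shows "\<exists>e. admissible_ends e \<and> J = block_of e"
  using assms unfolding is_block_def
proof (elim disjE exE conjE)
  fix a b :: ereal
  assume "a < b" "J = block_oo a b"
  then show ?thesis
    by (intro exI[of _ "\<lparr>left_open = a, right_closed = \<infinity>, left_closed = - \<infinity>, right_open = b\<rparr>"])
      (auto simp: admissible_ends_def block_of_def block_oo_def)
next
  fix a b
  assume "ereal a < b" "J = block_co a b"
  then show ?thesis
    by (intro exI[of _ "\<lparr>left_open = - \<infinity>, right_closed = \<infinity>, left_closed = ereal a, right_open = b\<rparr>"])
      (auto simp: admissible_ends_def block_of_def block_co_def)
next
  fix a b
  assume "a < ereal b" "J = block_oc a b"
  then show ?thesis
    by (intro exI[of _ "\<lparr>left_open = a, right_closed = ereal b, left_closed = - \<infinity>, right_open = \<infinity>\<rparr>"])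
      (auto simp: admissible_ends_def block_of_def block_oc_def)
next
  fix a b
  assume "J = block_cc a b"
  then show ?thesis
    by (intro exI[of _ "\<lparr>left_open = - \<infinity>, right_closed = ereal b, left_closed = ereal a, right_open = \<infinity>\<rparr>"])
      (auto simp: admissible_ends_def block_of_def block_cc_def)
qed

text \<open>Along the order \<open>x\<close> decreases and \<open>y\<close> increases, so closed
  bounds are births and open bounds are deaths. A nonzero map into the shifted target requires that
  no birth and no death of the target comes later than that of the source.\<close>

definition ends_hom :: "real \<Rightarrow> block_ends \<Rightarrow> block_ends \<Rightarrow> bool" where
  "ends_hom \<epsilon> e e' \<longleftrightarrow>
     left_closed e' \<le> left_closed e + ereal \<epsilon> \<and> right_open e' \<le> right_open e + ereal \<epsilon> \<and>
     left_open e \<le> left_open e' + ereal \<epsilon> \<and> right_closed e \<le> right_closed e' + ereal \<epsilon>"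

definition ends_near :: "real \<Rightarrow> block_ends \<Rightarrow> block_ends \<Rightarrow> bool" where
  "ends_near \<epsilon> e e' \<longleftrightarrow> ends_hom \<epsilon> e e' \<and> ends_hom \<epsilon> e' e"

lemma ends_near_sym: "ends_near \<epsilon> e e' \<longleftrightarrow> ends_near \<epsilon> e' e"
  by (auto simp: ends_near_def)

text \<open>
  Along morphisms an end can only change from closed to infinite to open; the rank counts these
  changes.
\<close>

definition ends_rank :: "block_ends \<Rightarrow> nat" where
  "ends_rank e = of_bool (left_closed e = - \<infinity>) + of_bool (left_open e \<noteq> - \<infinity>) +
     of_bool (right_closed e = \<infinity>) + of_bool (right_open e \<noteq> \<infinity>)"

text \<open>Infinite bounds contribute \<open>real_of_ereal (\<plusminus>\<infinity>) = 0\<close>.\<close>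

definition ends_weight :: "block_ends \<Rightarrow> real" where
  "ends_weight e = real_of_ereal (left_closed e) - real_of_ereal (left_open e) -
     real_of_ereal (right_closed e) + real_of_ereal (right_open e)"

text \<open>Length is measured on the diagonal, where the level set barcode lives; a block that
  misses the diagonal is never long.\<close>

definition long_ends :: "real \<Rightarrow> block_ends \<Rightarrow> bool" where
  "long_ends \<delta> e \<longleftrightarrow> (\<exists>t. (t, t) \<in> block_of e \<and> (t + \<delta>, t + \<delta>) \<in> block_of e)"

text \<open>The support condition for a nonzero constant map from the module of \<open>J\<close> to
  the shifted module of \<open>K\<close>: going up, the source must not die before the target; going
  down, the target must not be missing while the source is alive.\<close>

definition shift_closed :: "real \<Rightarrow> (real \<times> real) set \<Rightarrow> (real \<times> real) set \<Rightarrow> bool" where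
  "shift_closed \<epsilon> J K \<longleftrightarrow>
     (\<forall>p\<in>J. shift2 \<epsilon> p \<in> K \<longrightarrow>
        (\<forall>q\<in>upper_half. le_oprr p q \<longrightarrow> shift2 \<epsilon> q \<in> K \<longrightarrow> q \<in> J) \<and>
        (\<forall>r\<in>J. le_oprr r p \<longrightarrow> shift2 \<epsilon> r \<in> K))"

lemma mem_block_of:
  "(x, y) \<in> block_of e \<longleftrightarrow> x \<le> y \<and> left_open e < ereal x \<and> ereal x \<le> right_closed e \<and>
     left_closed e \<le> ereal y \<and> ereal y < right_open e"
  by (simp add: block_of_def upper_half_def)

text \<open>Starting from the common point \<open>p\<close>, a violated inequality for a death is
  refuted by moving up and one for a birth by moving down. The move down can cross the diagonal, so
  the other coordinate is adjusted beforehand; that this stays inside both blocks uses the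
  inequalities for deaths, which are therefore proved before.\<close>

lemma ends_homI:
  assumes adm: "admissible_ends e" "admissible_ends e'" and eps: "0 \<le> \<epsilon>"
    and closed: "shift_closed \<epsilon> (block_of e) (block_of e')"
    and p: "p \<in> block_of e" "shift2 \<epsilon> p \<in> block_of e'"
  shows "ends_hom \<epsilon> e e'"
proof -
  obtain x y where xy: "p = (x, y)"
    by fastforce
  have pe: "x \<le> y" "left_open e < ereal x" "ereal x \<le> right_closed e"
    "left_closed e \<le> ereal y" "ereal y < right_open e"
    and pe': "left_open e' < ereal (x - \<epsilon>)" "ereal (x - \<epsilon>) \<le> right_closed e'"
    "left_closed e' \<le> ereal (y + \<epsilon>)" "ereal (y + \<epsilon>) < right_open e'"
    using p by (auto simp: xy shift2_def mem_block_of)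
  have up: "(x', y') \<in> block_of e" if "x' \<le> x" "y \<le> y'" "shift2 \<epsilon> (x', y') \<in> block_of e'" for x' y'
  proof -
    have "(x', y') \<in> upper_half" "le_oprr p (x', y')"
      using that pe(1) by (simp_all add: upper_half_def xy le_oprr_def)
    then show ?thesis
      using closed p that(3) unfolding shift_closed_def by blast
  qed
  have down: "shift2 \<epsilon> (x'', y'') \<in> block_of e'"
    if "x' \<le> x''" "y'' \<le> y'" "(x', y') \<in> block_of e" "shift2 \<epsilon> (x', y') \<in> block_of e'"
      "(x'', y'') \<in> block_of e" for x' y' x'' y''
  proof -
    have "le_oprr (x'', y'') (x', y')"
      using that by (simp add: le_oprr_def)
    then show ?thesis
      using closed that(3-5) unfolding shift_closed_def by blast
  qed
  have D: "right_open e' \<le> right_open e + ereal \<epsilon>"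
  proof (rule ccontr)
    assume neg: "\<not> ?thesis"
    then obtain d where d: "right_open e = ereal d"
      using pe(5) by (cases "right_open e") auto
    have yd: "y < d" "ereal (d + \<epsilon>) < right_open e'"
      using pe(5) neg d by auto
    then have "left_closed e' \<le> ereal (d + \<epsilon>)"
      using pe'(3) by (elim order_trans) simp
    then have "(x, d) \<in> block_of e"
      using yd pe pe' eps by (intro up) (auto simp: shift2_def mem_block_of)
    then show False
      using d by (simp add: mem_block_of)
  qed
  have A: "left_open e \<le> left_open e' + ereal \<epsilon>"
  proof (rule ccontr)
    assume neg: "\<not> ?thesis"
    then obtain a where a: "left_open e = ereal a"
      using pe(2) by (cases "left_open e") auto
    have ax: "a < x" "left_open e' < ereal (a - \<epsilon>)"
      using pe(2) neg a by (auto, cases "left_open e'", auto)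
    then have "ereal (a - \<epsilon>) \<le> right_closed e'"
      using pe'(2) by (intro order_trans[OF _ pe'(2)]) simp
    then have "(a, y) \<in> block_of e"
      using ax pe pe' eps by (intro up) (auto simp: shift2_def mem_block_of)
    then show False
      using a by (simp add: mem_block_of)
  qed
  have C: "left_closed e' \<le> left_closed e + ereal \<epsilon>"
  proof (rule ccontr)
    assume neg: "\<not> ?thesis"
    then obtain c' where c': "left_closed e' = ereal c'"
      using pe'(3) by (cases "left_closed e'") auto
    then have A': "left_open e' = - \<infinity>"
      using adm by (auto simp: admissible_ends_def)
    \<comment> \<open>The left end of \<open>e'\<close> is closed, so neither block bounds
      \<open>x\<close> from below and \<open>x\<close> may be lowered freely.\<close>
    then have A0: "left_open e = - \<infinity>"
      using A by simp
    obtain y' where y': "left_closed e \<le> ereal y'" "y' + \<epsilon> < c'"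
    proof (cases "left_closed e")
      case (real c)
      then show ?thesis
        using neg c' that[of c] by auto
    next
      case MInf
      then show ?thesis
        using that[of "c' - \<epsilon> - 1"] by auto
    qed (use pe in auto)
    have y'y: "y' < y"
      using y' pe'(3) c' by simp
    \<comment> \<open>Keeps the point on the correct side of the diagonal when \<open>y\<close> is
      lowered to \<open>y'\<close>.\<close>
    define x' where "x' = min x y'"
    have x': "x' \<le> x" "x' \<le> y'" "x' \<le> y"
      using pe(1) y'y by (auto simp: x'_def)
    have x'B: "ereal x' \<le> right_closed e" "ereal (x' - \<epsilon>) \<le> right_closed e'"
      using x'(1) by (intro order_trans[OF _ pe(3)] order_trans[OF _ pe'(2)]; simp)+
    have y'D: "ereal y' < right_open e"
      using y'y by (intro le_less_trans[OF _ pe(5)]) simp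
    have "shift2 \<epsilon> (x', y') \<in> block_of e'"
    proof (rule down)
      show "x' \<le> x'" "y' \<le> y"
        using y'y by auto
      show "(x', y) \<in> block_of e" "shift2 \<epsilon> (x', y) \<in> block_of e'"
        using x' x'B pe(4,5) pe'(3,4) A0 A' eps by (simp_all add: mem_block_of shift2_def)
      show "(x', y') \<in> block_of e"
        using x' x'B y' y'D A0 by (simp add: mem_block_of)
    qed
    then show False
      using y'(2) c' by (simp add: mem_block_of shift2_def)
  qed
  have B: "right_closed e \<le> right_closed e' + ereal \<epsilon>"
  proof (rule ccontr)
    assume neg: "\<not> ?thesis"
    then obtain b' where b': "right_closed e' = ereal b'"
      using pe'(2) by (cases "right_closed e'") auto
    then have D': "right_open e' = \<infinity>"
      using adm by (auto simp: admissible_ends_def)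
    then have D0: "right_open e = \<infinity>"
      using D by (cases "right_open e") auto
    obtain x' where x': "ereal x' \<le> right_closed e" "b' < x' - \<epsilon>"
    proof (cases "right_closed e")
      case (real b)
      then show ?thesis
        using neg b' that[of b] by auto
    next
      case PInf
      then show ?thesis
        using that[of "b' + \<epsilon> + 1"] by auto
    qed (use pe in auto)
    have xx': "x < x'"
      using x' pe'(2) b' by simp
    define y' where "y' = max y x'"
    have y': "y \<le> y'" "x' \<le> y'" "x \<le> y'"
      using pe(1) xx' by (auto simp: y'_def)
    have y'C: "left_closed e \<le> ereal y'" "left_closed e' \<le> ereal (y' + \<epsilon>)"
      using y'(1) by (intro order_trans[OF pe(4)] order_trans[OF pe'(3)]; simp)+
    have x'A: "left_open e < ereal x'"
      using xx' by (intro less_trans[OF pe(2)]) simp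
    have "shift2 \<epsilon> (x', y') \<in> block_of e'"
    proof (rule down)
      show "x \<le> x'" "y' \<le> y'"
        using xx' by auto
      show "(x, y') \<in> block_of e" "shift2 \<epsilon> (x, y') \<in> block_of e'"
        using y' y'C pe(2,3) pe'(1,2) D0 D' eps by (simp_all add: mem_block_of shift2_def)
      show "(x', y') \<in> block_of e"
        using y' y'C x' x'A D0 by (simp add: mem_block_of)
    qed
    then show False
      using x'(2) b' by (simp add: mem_block_of shift2_def)
  qed
  show ?thesis
    using A B C D by (simp add: ends_hom_def)
qed

text \<open>The births of \<open>e'\<close> are controlled by \<open>e\<close> and its deaths by
  \<open>e''\<close>. So an intermediate bar with nonzero scalars on both sides is alive at every
  point where the composite is evaluated.\<close>

lemma ends_hom_middle:
  assumes "ends_hom \<epsilon> e e'" "ends_hom \<epsilon> e' e''" "0 \<le> \<epsilon>"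
    and "p \<in> block_of e" "shift2 (2 * \<epsilon>) p \<in> block_of e''"
  shows "shift2 \<epsilon> p \<in> block_of e'"
proof -
  obtain x y where xy: "p = (x, y)"
    by fastforce
  have *: "x \<le> y" "ereal x \<le> right_closed e" "left_closed e \<le> ereal y"
    "left_open e'' < ereal (x - 2 * \<epsilon>)" "ereal (y + 2 * \<epsilon>) < right_open e''"
    using assms(4,5) by (auto simp: xy mem_block_of shift2_def)
  have "left_closed e' \<le> ereal (y + \<epsilon>)"
    using assms(1) *(3) unfolding ends_hom_def
    by (metis add_right_mono order_trans plus_ereal.simps(1))
  moreover have "ereal (x - \<epsilon>) \<le> right_closed e'"
    using assms(1) *(2) unfolding ends_hom_def by (cases "right_closed e'"; cases "right_closed e") auto
  moreover have "left_open e' < ereal (x - \<epsilon>)"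
    using assms(2) *(4) unfolding ends_hom_def by (cases "left_open e'"; cases "left_open e''") auto
  moreover have "ereal (y + \<epsilon>) < right_open e'"
    using assms(2) *(5) unfolding ends_hom_def by (cases "right_open e'"; cases "right_open e''") auto
  ultimately show ?thesis
    using *(1) assms(3) by (simp add: xy mem_block_of shift2_def)
qed

section \<open>Kind, rank and weight of block ends\<close>

definition same_kind :: "block_ends \<Rightarrow> block_ends \<Rightarrow> bool" where
  "same_kind e e' \<longleftrightarrow>
     (left_open e = - \<infinity> \<longleftrightarrow> left_open e' = - \<infinity>) \<and> (left_closed e = - \<infinity> \<longleftrightarrow> left_closed e' = - \<infinity>) \<and>
     (right_closed e = \<infinity> \<longleftrightarrow> right_closed e' = \<infinity>) \<and> (right_open e = \<infinity> \<longleftrightarrow> right_open e' = \<infinity>)"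

text \<open>A finite shift does not change an infinite bound, so each of the four indicators in the
  rank can only be switched on. Equal ranks then force all four to agree.\<close>

lemma ends_rank_mono:
  assumes "admissible_ends e" "admissible_ends e'" "ends_hom \<epsilon> e e'"
  shows "ends_rank e \<le> ends_rank e'"
    and "ends_rank e = ends_rank e' \<Longrightarrow> same_kind e e'"
proof -
  have "left_closed e = - \<infinity> \<Longrightarrow> left_closed e' = - \<infinity>" "left_open e' = - \<infinity> \<Longrightarrow> left_open e = - \<infinity>"
    "right_closed e = \<infinity> \<Longrightarrow> right_closed e' = \<infinity>" "right_open e' = \<infinity> \<Longrightarrow> right_open e = \<infinity>"
    using assms by (cases "right_closed e'"; cases "right_open e"; force simp: ends_hom_def)+
  then show "ends_rank e \<le> ends_rank e'"
    and "ends_rank e = ends_rank e' \<Longrightarrow> same_kind e e'"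
    by (auto simp: ends_rank_def same_kind_def of_bool_def split: if_splits)
qed

lemma ereal_le_add_iff:
  "\<lbrakk>u \<noteq> \<infinity>; v \<noteq> \<infinity>; u = - \<infinity> \<longleftrightarrow> v = - \<infinity>\<rbrakk> \<Longrightarrow>
    u \<le> v + ereal \<epsilon> \<longleftrightarrow> u = - \<infinity> \<or> real_of_ereal u \<le> real_of_ereal v + \<epsilon>"
  "\<lbrakk>u \<noteq> - \<infinity>; v \<noteq> - \<infinity>; u = \<infinity> \<longleftrightarrow> v = \<infinity>\<rbrakk> \<Longrightarrow>
    u \<le> v + ereal \<epsilon> \<longleftrightarrow> u = \<infinity> \<or> real_of_ereal u \<le> real_of_ereal v + \<epsilon>"
  by (cases u; cases v; simp)+

lemma ends_hom_real:
  assumes "admissible_ends e" "admissible_ends e'" "same_kind e e'"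
  shows "ends_hom \<epsilon> e e' \<longleftrightarrow>
    (left_closed e = - \<infinity> \<or> real_of_ereal (left_closed e') \<le> real_of_ereal (left_closed e) + \<epsilon>) \<and>
    (right_open e = \<infinity> \<or> real_of_ereal (right_open e') \<le> real_of_ereal (right_open e) + \<epsilon>) \<and>
    (left_open e = - \<infinity> \<or> real_of_ereal (left_open e) \<le> real_of_ereal (left_open e') + \<epsilon>) \<and>
    (right_closed e = \<infinity> \<or> real_of_ereal (right_closed e) \<le> real_of_ereal (right_closed e') + \<epsilon>)"
  using assms unfolding ends_hom_def same_kind_def admissible_ends_def
  by (simp add: ereal_le_add_iff)

lemma same_kind_sym: "same_kind e e' \<Longrightarrow> same_kind e' e"
  by (auto simp: same_kind_def)

text \<open>The ranks agree throughout, so there are at most two finite ends to follow; taken with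
  the signs of the weight, each grows by at most \<open>\<epsilon>\<close> per step. If neither step
  were reversible up to \<open>\<epsilon>\<close>, each would lower some end by more than
  \<open>\<epsilon>\<close>. If it is the same end, it loses more than \<open>2 * \<epsilon>\<close>
  while the other gains at most that much. If the ends differ, each loses more in one step than it
  gains in the other. In both cases the weight would decrease strictly.\<close>

lemma ends_near_middle:
  assumes adm: "admissible_ends e" "admissible_ends e'" "admissible_ends e''"
    and hom: "ends_hom \<epsilon> e e'" "ends_hom \<epsilon> e' e''"
    and rank: "ends_rank e'' \<le> ends_rank e" and weight: "ends_weight e \<le> ends_weight e''"
  shows "ends_near \<epsilon> e e' \<or> ends_near \<epsilon> e' e''"
proof -
  have "ends_rank e = ends_rank e'" "ends_rank e' = ends_rank e''"
    using ends_rank_mono(1)[OF adm(1,2) hom(1)] ends_rank_mono(1)[OF adm(2,3) hom(2)] rank by auto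
  then have kind: "same_kind e e'" "same_kind e' e''"
    using ends_rank_mono(2)[OF adm(1,2) hom(1)] ends_rank_mono(2)[OF adm(2,3) hom(2)]
    by simp_all
  define a a' a'' where "a = real_of_ereal (left_open e)" "a' = real_of_ereal (left_open e')"
    "a'' = real_of_ereal (left_open e'')"
  define b b' b'' where "b = real_of_ereal (right_closed e)" "b' = real_of_ereal (right_closed e')"
    "b'' = real_of_ereal (right_closed e'')"
  define c c' c'' where "c = real_of_ereal (left_closed e)" "c' = real_of_ereal (left_closed e')"
    "c'' = real_of_ereal (left_closed e'')"
  define d d' d'' where "d = real_of_ereal (right_open e)" "d' = real_of_ereal (right_open e')"
    "d'' = real_of_ereal (right_open e'')"
  note defs = a_a'_a''_def b_b'_b''_def c_c'_c''_def d_d'_d''_def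
  have h: "left_closed e = - \<infinity> \<or> c' \<le> c + \<epsilon> \<and> c'' \<le> c' + \<epsilon>"
    "right_open e = \<infinity> \<or> d' \<le> d + \<epsilon> \<and> d'' \<le> d' + \<epsilon>"
    "left_open e = - \<infinity> \<or> a \<le> a' + \<epsilon> \<and> a' \<le> a'' + \<epsilon>"
    "right_closed e = \<infinity> \<or> b \<le> b' + \<epsilon> \<and> b' \<le> b'' + \<epsilon>"
    using hom kind unfolding ends_hom_real[OF adm(1,2) kind(1)] ends_hom_real[OF adm(2,3) kind(2)] defs
    by (auto simp: same_kind_def)
  have z: "left_closed e = - \<infinity> \<longrightarrow> c = 0 \<and> c' = 0 \<and> c'' = 0"
    "right_open e = \<infinity> \<longrightarrow> d = 0 \<and> d' = 0 \<and> d'' = 0"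
    "left_open e = - \<infinity> \<longrightarrow> a = 0 \<and> a' = 0 \<and> a'' = 0"
    "right_closed e = \<infinity> \<longrightarrow> b = 0 \<and> b' = 0 \<and> b'' = 0"
    using kind unfolding defs same_kind_def by auto
  have w: "c - a - b + d \<le> c'' - a'' - b'' + d''"
    using weight by (simp add: ends_weight_def defs)
  \<comment> \<open>At most one finite bound on each side. With three independent ends the gains of
    two could outweigh the losses of the third.\<close>
  have x: "left_open e = - \<infinity> \<or> left_closed e = - \<infinity>" "right_closed e = \<infinity> \<or> right_open e = \<infinity>"
    using adm(1) by (auto simp: admissible_ends_def)
  have "((left_closed e = - \<infinity> \<or> c \<le> c' + \<epsilon>) \<and> (right_open e = \<infinity> \<or> d \<le> d' + \<epsilon>) \<and>
      (left_open e = - \<infinity> \<or> a' \<le> a + \<epsilon>) \<and> (right_closed e = \<infinity> \<or> b' \<le> b + \<epsilon>)) \<or>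
    ((left_closed e = - \<infinity> \<or> c' \<le> c'' + \<epsilon>) \<and> (right_open e = \<infinity> \<or> d' \<le> d'' + \<epsilon>) \<and>
      (left_open e = - \<infinity> \<or> a'' \<le> a' + \<epsilon>) \<and> (right_closed e = \<infinity> \<or> b'' \<le> b' + \<epsilon>))"
    using h z w x by argo
  then have "ends_hom \<epsilon> e' e \<or> ends_hom \<epsilon> e'' e'"
    using kind unfolding ends_hom_real[OF adm(2,1) same_kind_sym[OF kind(1)]]
      ends_hom_real[OF adm(3,2) same_kind_sym[OF kind(2)]] defs by (auto simp: same_kind_def)
  then show ?thesis
    using hom by (auto simp: ends_near_def)
qed

text \<open>It suffices to satisfy the births of \<open>e\<close> and the deaths of
  \<open>e''\<close>; the other bounds follow from \<open>hom\<close>. For a left end closed at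
  \<open>c\<close> and a right end open at \<open>d\<close>, weight and \<open>hom\<close> give
  \<open>d'' \<ge> d - 2 * \<epsilon>\<close>, so there is room between \<open>c\<close> and
  \<open>d''\<close> for the shift as soon as \<open>d - c > 4 * \<epsilon>\<close>. For two finite
  open ends the weight is the length, which does not shrink.\<close>

lemma ends_hom_common_point:
  assumes adm: "admissible_ends e" "admissible_ends e''" and eps: "0 \<le> \<epsilon>"
    and hom: "ends_hom (2 * \<epsilon>) e e''" and rank: "ends_rank e'' \<le> ends_rank e"
    and weight: "ends_weight e \<le> ends_weight e''" and long: "long_ends (10 * \<epsilon>) e"
  shows "\<exists>p\<in>block_of e. shift2 (2 * \<epsilon>) p \<in> block_of e''"
proof -
  have "ends_rank e = ends_rank e''"
    using ends_rank_mono(1)[OF adm hom] rank by simp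
  then have kind: "same_kind e e''"
    by (rule ends_rank_mono(2)[OF adm hom])
  obtain t where t: "left_open e < ereal t" "left_closed e \<le> ereal t"
    "ereal (t + 10 * \<epsilon>) \<le> right_closed e" "ereal (t + 10 * \<epsilon>) < right_open e"
    using long by (auto simp: long_ends_def mem_block_of)
  have "\<exists>x y. x \<le> y \<and> left_open e'' < ereal (x - 2 * \<epsilon>) \<and> ereal x \<le> right_closed e \<and>
      left_closed e \<le> ereal y \<and> ereal (y + 2 * \<epsilon>) < right_open e''"
  proof (cases "left_open e = - \<infinity>")
    case A: True
    then have A'': "left_open e'' = - \<infinity>"
      using kind by (simp add: same_kind_def)
    show ?thesis
    proof (cases "right_open e = \<infinity>")
      case True
      then have "right_open e'' = \<infinity>"
        using kind by (simp add: same_kind_def)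
      moreover have "ereal t \<le> right_closed e"
        using t(3) eps by (intro order_trans[OF _ t(3)]) simp
      ultimately show ?thesis
        using A'' t by (intro exI[of _ t]) simp
    next
      case D: False
      then have B: "right_closed e = \<infinity>" and D'': "right_open e'' \<noteq> \<infinity>" and B'': "right_closed e'' = \<infinity>"
        using adm kind by (auto simp: admissible_ends_def same_kind_def)
      obtain d d'' where d: "right_open e = ereal d" "right_open e'' = ereal d''"
        using D D'' adm by (cases "right_open e"; cases "right_open e''") (auto simp: admissible_ends_def)
      show ?thesis
      proof (cases "left_closed e = - \<infinity>")
        case True
        then show ?thesis
          using A'' B d by (intro exI[of _ "d'' - 2 * \<epsilon> - 1"]) simp
      next
        case False
        then obtain c c'' where c: "left_closed e = ereal c" "left_closed e'' = ereal c''"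
          using kind adm by (cases "left_closed e"; cases "left_closed e''")
            (auto simp: admissible_ends_def same_kind_def)
        have "c + d \<le> c'' + d''" "c'' \<le> c + 2 * \<epsilon>" "c + 10 * \<epsilon> < d"
          using weight hom t A A'' B B'' by (auto simp: ends_weight_def ends_hom_def c d)
        then show ?thesis
          using A'' B d c eps by (intro exI[of _ c]) simp
      qed
    qed
  next
    case A: False
    then have C: "left_closed e = - \<infinity>" "left_closed e'' = - \<infinity>" and "left_open e'' \<noteq> - \<infinity>"
      using adm kind by (auto simp: admissible_ends_def same_kind_def)
    then obtain a a'' where a: "left_open e = ereal a" "left_open e'' = ereal a''"
      using A adm by (cases "left_open e"; cases "left_open e''") (auto simp: admissible_ends_def)
    show ?thesis
    proof (cases "right_open e = \<infinity>")
      case D: True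
      then have D'': "right_open e'' = \<infinity>"
        using kind by (simp add: same_kind_def)
      show ?thesis
      proof (cases "right_closed e = \<infinity>")
        case True
        then show ?thesis
          using C D'' a by (intro exI[of _ "a'' + 2 * \<epsilon> + 1"]) simp
      next
        case False
        then obtain b b'' where b: "right_closed e = ereal b" "right_closed e'' = ereal b''"
          using kind adm by (cases "right_closed e"; cases "right_closed e''")
            (auto simp: admissible_ends_def same_kind_def)
        have "a'' + b'' \<le> a + b" "b \<le> b'' + 2 * \<epsilon>" "a + 10 * \<epsilon> < b"
          using weight hom t C D D'' by (auto simp: ends_weight_def ends_hom_def a b)
        then show ?thesis
          using C D'' a b eps by (intro exI[of _ b]) simp
      qed
    next
      case D: False
      then have B: "right_closed e = \<infinity>" and D'': "right_open e'' \<noteq> \<infinity>" and B'': "right_closed e'' = \<infinity>"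
        using adm kind by (auto simp: admissible_ends_def same_kind_def)
      obtain d d'' where d: "right_open e = ereal d" "right_open e'' = ereal d''"
        using D D'' adm by (cases "right_open e"; cases "right_open e''") (auto simp: admissible_ends_def)
      have "d - a \<le> d'' - a''" "a + 10 * \<epsilon> < d"
        using weight t C B B'' by (auto simp: ends_weight_def a d)
      \<comment> \<open>The point lies over the midpoint of the bar of \<open>e''\<close>, which is
        at least as long as that of \<open>e\<close> and so leaves room for the shift on both
        sides.\<close>
      then show ?thesis
        using C B a d eps by (intro exI[of _ "(a'' + d'') / 2"]) (simp add: field_simps)
    qed
  qed
  then obtain x y where xy: "x \<le> y" "left_open e'' < ereal (x - 2 * \<epsilon>)" "ereal x \<le> right_closed e"
    "left_closed e \<le> ereal y" "ereal (y + 2 * \<epsilon>) < right_open e''"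
    by blast
  have "left_open e < ereal x"
    using xy(2) hom by (cases "left_open e''"; cases "left_open e") (auto simp: ends_hom_def)
  moreover have "ereal y < right_open e"
    using xy(5) hom by (cases "right_open e''"; cases "right_open e") (auto simp: ends_hom_def)
  moreover have "left_closed e'' \<le> ereal (y + 2 * \<epsilon>)"
    using xy(4) hom by (cases "left_closed e''"; cases "left_closed e") (auto simp: ends_hom_def)
  moreover have "ereal (x - 2 * \<epsilon>) \<le> right_closed e''"
    using xy(3) hom by (cases "right_closed e''"; cases "right_closed e") (auto simp: ends_hom_def)
  ultimately have "(x, y) \<in> block_of e" "shift2 (2 * \<epsilon>) (x, y) \<in> block_of e''"
    using xy eps by (simp_all add: mem_block_of shift2_def)
  then show ?thesis
    by blast
qed

lemma ends_hom_trans: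
  assumes "ends_hom \<epsilon> e e'" "ends_hom \<delta> e' e''"
  shows "ends_hom (\<epsilon> + \<delta>) e e''"
proof -
  have "u'' \<le> u + ereal (\<epsilon> + \<delta>)" if "u' \<le> u + ereal \<epsilon>" "u'' \<le> u' + ereal \<delta>" for u u' u''
    using that by (cases u; cases u'; cases u''; auto)
  moreover have "u'' \<le> u + ereal (\<epsilon> + \<delta>)" if "u' \<le> u + ereal \<delta>" "u'' \<le> u' + ereal \<epsilon>" for u u' u''
    using that by (cases u; cases u'; cases u''; auto)
  ultimately show ?thesis
    using assms unfolding ends_hom_def by blast
qed

lemma ends_hom_refl: "0 \<le> \<epsilon> \<Longrightarrow> ends_hom \<epsilon> e e"
proof -
  assume "0 \<le> \<epsilon>"
  then have "u \<le> u + ereal \<epsilon>" for u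
    by (cases u) auto
  then show ?thesis
    by (simp add: ends_hom_def)
qed

text \<open>Ends move by at most \<open>\<epsilon>\<close>, so the middle of a long stretch
  survives. The point depends on \<open>e\<close> alone, so all bars near \<open>e\<close> meet in
  one level; this bounds their number later.\<close>

lemma ends_near_mid_point:
  assumes near: "ends_near \<epsilon> e e'" and eps: "0 \<le> \<epsilon>"
    and t: "(t, t) \<in> block_of e" "(t + 10 * \<epsilon>, t + 10 * \<epsilon>) \<in> block_of e"
  shows "(t + 5 * \<epsilon>, t + 5 * \<epsilon>) \<in> block_of e'"
proof -
  have *: "left_open e < ereal t" "left_closed e \<le> ereal t"
    "ereal (t + 10 * \<epsilon>) \<le> right_closed e" "ereal (t + 10 * \<epsilon>) < right_open e"
    using t by (auto simp: mem_block_of)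
  have hom: "ends_hom \<epsilon> e e'" "ends_hom \<epsilon> e' e"
    using near by (auto simp: ends_near_def)
  have "left_open e' < ereal (t + 5 * \<epsilon>)"
    using *(1) hom(2) eps by (cases "left_open e'"; cases "left_open e") (auto simp: ends_hom_def)
  moreover have "left_closed e' \<le> ereal (t + 5 * \<epsilon>)"
    using *(2) hom(1) eps by (cases "left_closed e'"; cases "left_closed e") (auto simp: ends_hom_def)
  moreover have "ereal (t + 5 * \<epsilon>) \<le> right_closed e'"
    using *(3) hom(1) eps by (cases "right_closed e'"; cases "right_closed e") (auto simp: ends_hom_def)
  moreover have "ereal (t + 5 * \<epsilon>) < right_open e'"
    using *(4) hom(2) eps by (cases "right_open e'"; cases "right_open e") (auto simp: ends_hom_def)
  ultimately show ?thesis
    by (simp add: mem_block_of)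
qed

lemma interval_interleaved_if_near:
  assumes near: "ends_near \<epsilon> e e'" and eps: "0 \<le> \<epsilon>"
  shows "interval_interleaved TYPE('k::field) (5 * \<epsilon>)
    (diagonal_part (block_of e)) (diagonal_part (block_of e'))"
proof -
  \<comment> \<open>On the line, a bar is the intersection of an up-set \<open>L\<close>, which
    records the birth, with a down-set \<open>R\<close>, which records the death. Each half can be
    shifted separately.\<close>
  define L where "L e = {t. left_open e < ereal t \<and> left_closed e \<le> ereal t}"
    for e :: block_ends
  define R where "R e = {t. ereal t \<le> right_closed e \<and> ereal t < right_open e}"
    for e :: block_ends
  have diag: "diagonal_part (block_of e) = L e \<inter> R e" for e
    by (auto simp: diagonal_part_def mem_block_of L_def R_def)
  define \<delta> where "\<delta> = 5 * \<epsilon>"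
  have shift: "(t \<in> L e \<longrightarrow> t + \<delta> \<in> L e') \<and> (t + \<delta> \<in> R e' \<longrightarrow> t \<in> R e)"
    if "ends_hom \<epsilon> e e'" "ends_hom \<epsilon> e' e" for e e' t
  proof -
    have "left_open e' < ereal (t + \<delta>)" if "left_open e < ereal t"
      using that \<open>ends_hom \<epsilon> e' e\<close> eps
      by (cases "left_open e'"; cases "left_open e") (auto simp: ends_hom_def \<delta>_def)
    moreover have "left_closed e' \<le> ereal (t + \<delta>)" if "left_closed e \<le> ereal t"
      using that \<open>ends_hom \<epsilon> e e'\<close> eps
      by (cases "left_closed e'"; cases "left_closed e") (auto simp: ends_hom_def \<delta>_def)
    moreover have "ereal t \<le> right_closed e" if "ereal (t + \<delta>) \<le> right_closed e'"
      using that \<open>ends_hom \<epsilon> e' e\<close> eps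
      by (cases "right_closed e'"; cases "right_closed e") (auto simp: ends_hom_def \<delta>_def)
    moreover have "ereal t < right_open e" if "ereal (t + \<delta>) < right_open e'"
      using that \<open>ends_hom \<epsilon> e e'\<close> eps
      by (cases "right_open e'"; cases "right_open e") (auto simp: ends_hom_def \<delta>_def)
    ultimately show ?thesis
      by (simp add: L_def R_def)
  qed
  have L_up: "t \<in> L e" if "s \<in> L e" "s \<le> t" for s t e
    using that by (auto simp: L_def intro: less_le_trans[of _ "ereal s"] order_trans[of _ "ereal s"])
  have R_down: "s \<in> R e" if "t \<in> R e" "s \<le> t" for s t e
    using that by (auto simp: R_def intro: le_less_trans[of _ "ereal t"] order_trans[of _ "ereal t"])
  define h where "h e e' t x = (if t \<in> L e \<inter> R e \<and> t + \<delta> \<in> L e' \<inter> R e' then x else 0)"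
    for e e' and t :: real and x :: 'k
  have nat: "vec_nat_trans UNIV (\<le>) (interval_module (L e \<inter> R e))
      (vec_diagram_shift \<delta> (interval_module (L e' \<inter> R e'))) (h e e')"
    if "ends_hom \<epsilon> e e'" "ends_hom \<epsilon> e' e" for e e'
    unfolding vec_nat_trans_def
  proof (intro conjI ballI impI)
    fix t
    show "linear_map_between (vec_at (interval_module (L e \<inter> R e)) t)
        (vec_at (vec_diagram_shift \<delta> (interval_module (L e' \<inter> R e'))) t) (h e e' t)"
      by (auto simp: linear_map_between_def interval_module_def vec_diagram_shift_def h_def)
  next
    fix s t :: real and x :: 'k
    assume st: "s \<le> t" and x: "x \<in> carrier (vec_at (interval_module (L e \<inter> R e)) s)"
    have *: "vec_map (interval_module (L e \<inter> R e)) s t x = (if s \<in> L e \<inter> R e \<and> t \<in> L e \<inter> R e then x else 0)"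
      "vec_map (vec_diagram_shift \<delta> (interval_module (L e' \<inter> R e'))) s t y =
        (if s + \<delta> \<in> L e' \<inter> R e' \<and> t + \<delta> \<in> L e' \<inter> R e' then y else 0)" for y
      by (simp_all add: interval_module_def vec_diagram_shift_def)
    show "h e e' t (vec_map (interval_module (L e \<inter> R e)) s t x) =
        vec_map (vec_diagram_shift \<delta> (interval_module (L e' \<inter> R e'))) s t (h e e' s x)"
    proof (cases "s \<in> L e \<inter> R e")
      case True
      then have "s + \<delta> \<in> L e'" "t \<in> L e" "t + \<delta> \<in> L e'"
        using shift[OF that] L_up[of s e t] st by auto
      moreover have "t + \<delta> \<in> R e' \<longrightarrow> s + \<delta> \<in> R e' \<and> t \<in> R e"
        using shift[OF that] R_down[of "t + \<delta>" e' "s + \<delta>"] st by simp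
      ultimately show ?thesis
        using True unfolding * h_def by simp
    next
      case False
      then have "x = 0"
        using x by (simp add: interval_module_def split: if_splits)
      then show ?thesis
        unfolding * h_def by simp
    qed
  qed
  have comp: "h e' e (t + \<delta>) (h e e' t x) = vec_map (interval_module (L e \<inter> R e)) t (t + 2 * \<delta>) x"
    if "ends_hom \<epsilon> e e'" "ends_hom \<epsilon> e' e" for e e' t x
  proof -
    have eq: "t + 2 * \<delta> = t + \<delta> + \<delta>"
      by simp
    \<comment> \<open>Where the internal map of the outer bar is not zero, the other bar is alive
      halfway, so the composite of the two partial identities is not cut off.\<close>
    have "t \<in> L e \<and> t + \<delta> + \<delta> \<in> R e \<longrightarrow> t + \<delta> \<in> L e' \<inter> R e'"
      using shift[OF that, of t] shift[OF that(2,1), of "t + \<delta>"] by simp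
    then show ?thesis
      unfolding eq interval_module_def h_def by simp
  qed
  have "ends_hom \<epsilon> e e'" "ends_hom \<epsilon> e' e"
    using near by (auto simp: ends_near_def)
  then show ?thesis
    unfolding interval_interleaved_def vec_interleaved_def diag \<delta>_def[symmetric]
    using nat[of e e'] nat[of e' e] comp[of e e'] comp[of e' e] by (intro exI conjI allI ballI)
qed

section \<open>Interleavings of sums of blocks\<close>

text \<open>The value of a sum of bars at \<open>p\<close>. Vectors are 0 outside the index set, so
  that addition and equality are those of plain functions.\<close>

definition fin_vecs :: "('i, (real \<times> real) set) family \<Rightarrow> real \<times> real \<Rightarrow> ('i \<Rightarrow> 'k::field) set" where
  "fin_vecs B p = {v. finite {i. v i \<noteq> 0} \<and> (\<forall>i. v i \<noteq> 0 \<longrightarrow> i \<in> fst B \<and> p \<in> snd B i)}"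

definition cut_vec ::
  "('i, (real \<times> real) set) family \<Rightarrow> real \<times> real \<Rightarrow> ('i \<Rightarrow> 'k::field) \<Rightarrow> 'i \<Rightarrow> 'k" where
  "cut_vec B q v = (\<lambda>i. if i \<in> fst B \<and> q \<in> snd B i then v i else 0)"

definition unit_at :: "'i \<Rightarrow> 'i \<Rightarrow> 'k::field" where
  "unit_at i = (\<lambda>k. if k = i then 1 else 0)"

definition join_point :: "real \<times> real \<Rightarrow> real \<times> real \<Rightarrow> real \<times> real" where
  "join_point p q = (min (fst p) (fst q), max (snd p) (snd q))"

text \<open>Every bound of a block concerns a single coordinate, and each coordinate of the join is
  taken from one of the two points.\<close>

lemma join_point_block:
  assumes "p \<in> block_of e" "q \<in> block_of e"
  shows "join_point p q \<in> block_of e"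
  using assms by (cases p; cases q) (auto simp: join_point_def mem_block_of min_def max_def)

lemma join_point_upper: "le_oprr p (join_point p q)" "le_oprr q (join_point p q)"
  by (auto simp: join_point_def le_oprr_def)

lemma shift2_join_point: "shift2 \<epsilon> (join_point p q) = join_point (shift2 \<epsilon> p) (shift2 \<epsilon> q)"
  by (auto simp: join_point_def shift2_def min_def max_def)

lemma block_of_upper_half: "p \<in> block_of e \<Longrightarrow> p \<in> upper_half"
  by (auto simp: block_of_def)

lemma unit_at_fin_vecs: "i \<in> fst B \<Longrightarrow> p \<in> snd B i \<Longrightarrow> unit_at i \<in> fin_vecs B p"
  by (auto simp: fin_vecs_def unit_at_def)

locale block_morphism =
  fixes \<epsilon> :: real
    and B :: "('i, (real \<times> real) set) family" and B' :: "('j, (real \<times> real) set) family"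
    and e :: "'i \<Rightarrow> block_ends" and e' :: "'j \<Rightarrow> block_ends"
    and F :: "real \<times> real \<Rightarrow> ('i \<Rightarrow> 'k::field) \<Rightarrow> 'j \<Rightarrow> 'k"
  assumes eps: "0 \<le> \<epsilon>"
    and ends: "\<And>i. i \<in> fst B \<Longrightarrow> admissible_ends (e i)" "\<And>i. i \<in> fst B \<Longrightarrow> snd B i = block_of (e i)"
    and ends': "\<And>j. j \<in> fst B' \<Longrightarrow> admissible_ends (e' j)" "\<And>j. j \<in> fst B' \<Longrightarrow> snd B' j = block_of (e' j)"
    and range: "\<And>p v. p \<in> upper_half \<Longrightarrow> v \<in> fin_vecs B p \<Longrightarrow> F p v \<in> fin_vecs B' (shift2 \<epsilon> p)"
    and add: "\<And>p v w. p \<in> upper_half \<Longrightarrow> v \<in> fin_vecs B p \<Longrightarrow> w \<in> fin_vecs B p \<Longrightarrow>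
      F p (\<lambda>i. v i + w i) = (\<lambda>j. F p v j + F p w j)"
    and scale: "\<And>p c v. p \<in> upper_half \<Longrightarrow> v \<in> fin_vecs B p \<Longrightarrow>
      F p (\<lambda>i. c * v i) = (\<lambda>j. c * F p v j)"
    and natural: "\<And>p q v. p \<in> upper_half \<Longrightarrow> q \<in> upper_half \<Longrightarrow> le_oprr p q \<Longrightarrow> v \<in> fin_vecs B p \<Longrightarrow>
      F q (cut_vec B q v) = cut_vec B' (shift2 \<epsilon> q) (F p v)"
begin

lemma point_upper_half: "i \<in> fst B \<Longrightarrow> p \<in> snd B i \<Longrightarrow> p \<in> upper_half"
  using ends(2) block_of_upper_half by blast

lemma apply_zero:
  assumes "p \<in> upper_half"
  shows "F p (\<lambda>_. 0) = (\<lambda>_. 0)"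
proof -
  have "(\<lambda>_. 0) \<in> fin_vecs B p"
    by (simp add: fin_vecs_def)
  from scale[OF assms this, of 0] show ?thesis
    by simp
qed

lemma apply_expand:
  assumes p: "p \<in> upper_half" and v: "v \<in> fin_vecs B p"
  shows "F p v j = (\<Sum>i | v i \<noteq> 0. v i * F p (unit_at i) j)"
proof -
  have "F p (\<lambda>i. if i \<in> S then v i else 0) j = (\<Sum>i\<in>S. v i * F p (unit_at i) j)"
    if "finite S" "\<And>i. i \<in> S \<Longrightarrow> i \<in> fst B \<and> p \<in> snd B i" for S
    using that
  proof (induction S rule: finite_induct)
    case empty
    then show ?case
      using apply_zero[OF p] by simp
  next
    case (insert k S)
    have unit: "unit_at k \<in> fin_vecs B p"
      using insert.prems by (intro unit_at_fin_vecs) auto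
    moreover have "(\<lambda>i. v k * unit_at k i) \<in> fin_vecs B p"
      using insert.prems by (auto simp: fin_vecs_def unit_at_def)
    moreover have "(\<lambda>i. if i \<in> S then v i else 0) \<in> fin_vecs B p"
      using insert.prems insert.hyps(1) by (auto simp: fin_vecs_def)
    moreover have "(\<lambda>i. if i \<in> insert k S then v i else 0) =
        (\<lambda>i. v k * unit_at k i + (if i \<in> S then v i else 0))"
      using insert.hyps by (auto simp: unit_at_def fun_eq_iff)
    ultimately show ?case
      using insert scale[OF p unit, of "v k"] by (simp add: add[OF p])
  qed
  note * = this
  have "(\<lambda>i. if i \<in> {i. v i \<noteq> 0} then v i else 0) = v"
    by auto
  then show ?thesis
    using *[of "{i. v i \<noteq> 0}"] v by (simp add: fin_vecs_def)
qed

lemma apply_unit_support: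
  assumes "i \<in> fst B" "p \<in> snd B i"
  shows "finite {j. F p (unit_at i) j \<noteq> 0}"
    and "F p (unit_at i) j \<noteq> 0 \<Longrightarrow> j \<in> fst B' \<and> shift2 \<epsilon> p \<in> snd B' j"
  using range[OF point_upper_half[OF assms] unit_at_fin_vecs[OF assms]] by (auto simp: fin_vecs_def)

text \<open>Naturality on a basis vector: while the target bar \<open>j\<close> lasts, its
  coordinate is carried along unchanged, so it must be 0 if the source bar \<open>i\<close> has died
  by then.\<close>

lemma apply_unit_step:
  assumes i: "i \<in> fst B" "p \<in> snd B i" and j: "j \<in> fst B'" "shift2 \<epsilon> q \<in> snd B' j"
    and q: "q \<in> upper_half" "le_oprr p q"
  shows "F p (unit_at i) j = (if q \<in> snd B i then F q (unit_at i) j else 0)"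
proof -
  have p: "p \<in> upper_half"
    using i by (rule point_upper_half)
  have "F p (unit_at i) j = F q (cut_vec B q (unit_at i)) j"
    unfolding natural[OF p q unit_at_fin_vecs[OF i]] using j by (simp add: cut_vec_def)
  moreover have "cut_vec B q (unit_at i :: 'i \<Rightarrow> 'k) = (if q \<in> snd B i then unit_at i else (\<lambda>_. 0))"
    using i(1) by (auto simp: cut_vec_def unit_at_def)
  ultimately show ?thesis
    using apply_zero[OF q(1)] by (cases "q \<in> snd B i") simp_all
qed

text \<open>Both values are compared with the one at the join, which lies in both blocks.\<close>

lemma apply_unit_const:
  assumes i: "i \<in> fst B" and j: "j \<in> fst B'"
    and p: "p \<in> snd B i" "shift2 \<epsilon> p \<in> snd B' j" and q: "q \<in> snd B i" "shift2 \<epsilon> q \<in> snd B' j"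
  shows "F p (unit_at i) j = F q (unit_at i) j"
proof -
  let ?r = "join_point p q"
  have r: "?r \<in> snd B i" "shift2 \<epsilon> ?r \<in> snd B' j"
    using p q i j ends(2) ends'(2) by (auto simp: join_point_block shift2_join_point)
  have "?r \<in> upper_half"
    using i r(1) by (rule point_upper_half)
  then show ?thesis
    using apply_unit_step[OF i p(1) j r(2)] apply_unit_step[OF i q(1) j r(2)] r(1) join_point_upper
    by simp
qed

text \<open>The default 0 ensures that a nonzero scalar comes with a point where both bars are
  alive.\<close>

definition coeff :: "'i \<Rightarrow> 'j \<Rightarrow> 'k" where
  "coeff i j = (if \<exists>p. p \<in> snd B i \<and> shift2 \<epsilon> p \<in> snd B' j
     then F (SOME p. p \<in> snd B i \<and> shift2 \<epsilon> p \<in> snd B' j) (unit_at i) j else 0)"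

lemma apply_unit_eq_coeff:
  assumes "i \<in> fst B" "j \<in> fst B'" "p \<in> snd B i" "shift2 \<epsilon> p \<in> snd B' j"
  shows "F p (unit_at i) j = coeff i j"
proof -
  have ex: "\<exists>p. p \<in> snd B i \<and> shift2 \<epsilon> p \<in> snd B' j"
    using assms by blast
  from someI_ex[OF this] show ?thesis
    using ex apply_unit_const[OF assms] unfolding coeff_def by simp
qed

text \<open>A nonzero scalar is nonzero at every common point; \<open>apply_unit_step\<close>, read
  upwards and downwards, then yields both halves of \<open>shift_closed\<close>.\<close>

lemma ends_hom_if_coeff:
  assumes i: "i \<in> fst B" and j: "j \<in> fst B'" and nz: "coeff i j \<noteq> 0"
  shows "ends_hom \<epsilon> (e i) (e' j)"
proof -
  obtain p where p: "p \<in> snd B i" "shift2 \<epsilon> p \<in> snd B' j"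
    using nz unfolding coeff_def by (meson)
  have "shift_closed \<epsilon> (snd B i) (snd B' j)"
    unfolding shift_closed_def
  proof (intro ballI impI conjI)
    fix p q
    assume p: "p \<in> snd B i" "shift2 \<epsilon> p \<in> snd B' j"
      and q: "q \<in> upper_half" "le_oprr p q" "shift2 \<epsilon> q \<in> snd B' j"
    have "F p (unit_at i) j \<noteq> 0"
      using nz apply_unit_eq_coeff[OF i j p] by simp
    then show "q \<in> snd B i"
      unfolding apply_unit_step[OF i p(1) j q(3,1,2)] by presburger
  next
    fix p r
    assume p: "p \<in> snd B i" "shift2 \<epsilon> p \<in> snd B' j" and r: "r \<in> snd B i" "le_oprr r p"
    have "F r (unit_at i) j = F p (unit_at i) j"
      using apply_unit_step[OF i r(1) j p(2) point_upper_half[OF i p(1)] r(2)] p(1) by simp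
    then have "F r (unit_at i) j \<noteq> 0"
      using nz apply_unit_eq_coeff[OF i j p] by simp
    then show "shift2 \<epsilon> r \<in> snd B' j"
      using apply_unit_support(2)[OF i r(1)] by blast
  qed
  then show ?thesis
    using ends_homI[OF ends(1)[OF i] ends'(1)[OF j] eps] p ends(2)[OF i] ends'(2)[OF j] by simp
qed

end

text \<open>One of the two interleaving identities, which is enough to inject the long bars of
  \<open>B\<close> into \<open>B'\<close>; the other direction is the same locale with the roles
  exchanged. Finiteness is asked of the bars that serve as partners.\<close>

locale block_interleaving =
  F: block_morphism \<epsilon> B B' e e' F + G: block_morphism \<epsilon> B' B e' e G
  for \<epsilon> :: real
    and B :: "('i, (real \<times> real) set) family" and B' :: "('j, (real \<times> real) set) family"
    and e :: "'i \<Rightarrow> block_ends" and e' :: "'j \<Rightarrow> block_ends"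
    and F :: "real \<times> real \<Rightarrow> ('i \<Rightarrow> 'k::field) \<Rightarrow> 'j \<Rightarrow> 'k"
    and G :: "real \<times> real \<Rightarrow> ('j \<Rightarrow> 'k) \<Rightarrow> 'i \<Rightarrow> 'k" +
  assumes comp: "\<And>p v. p \<in> upper_half \<Longrightarrow> v \<in> fin_vecs B p \<Longrightarrow>
      G (shift2 \<epsilon> p) (F p v) = cut_vec B (shift2 (2 * \<epsilon>) p) v"
    and finite_diagonal: "\<And>t. finite {j \<in> fst B'. (t, t) \<in> snd B' j}"
begin

abbreviation long_set :: "'i set" where
  "long_set \<equiv> {i \<in> fst B. long_ends (10 * \<epsilon>) (e i)}"

abbreviation near_set :: "'i \<Rightarrow> 'j set" where
  "near_set i \<equiv> {j \<in> fst B'. ends_near \<epsilon> (e i) (e' j)}"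

lemma finite_near_set:
  assumes "i \<in> long_set"
  shows "finite (near_set i)"
proof -
  obtain t where t: "(t, t) \<in> block_of (e i)" "(t + 10 * \<epsilon>, t + 10 * \<epsilon>) \<in> block_of (e i)"
    using assms by (auto simp: long_ends_def)
  have "near_set i \<subseteq> {j \<in> fst B'. (t + 5 * \<epsilon>, t + 5 * \<epsilon>) \<in> snd B' j}"
    using ends_near_mid_point[OF _ F.eps t] F.ends'(2) by auto
  then show ?thesis
    using finite_diagonal finite_subset by blast
qed

text \<open>At a point where both outer bars are alive, the composite has the entry of the internal
  map, which is that of the identity matrix.\<close>

lemma sum_coeff_products:
  assumes i: "i \<in> fst B" "i' \<in> fst B" and p: "p \<in> snd B i" "shift2 (2 * \<epsilon>) p \<in> snd B i'"
  shows "(\<Sum>j | F p (unit_at i) j \<noteq> 0. F.coeff i j * G.coeff j i') = (if i = i' then 1 else 0)"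
proof -
  have pU: "p \<in> upper_half"
    using i(1) p(1) by (rule F.point_upper_half)
  have pU': "shift2 \<epsilon> p \<in> upper_half"
    using F.eps pU by (rule shift2_in_upper_half)
  have v: "F p (unit_at i) \<in> fin_vecs B' (shift2 \<epsilon> p)"
    by (rule F.range[OF pU unit_at_fin_vecs[OF i(1) p(1)]])
  have "(if i = i' then 1 else 0) = G (shift2 \<epsilon> p) (F p (unit_at i)) i'"
    unfolding comp[OF pU unit_at_fin_vecs[OF i(1) p(1)]] using i p by (auto simp: cut_vec_def unit_at_def)
  also have "\<dots> = (\<Sum>j | F p (unit_at i) j \<noteq> 0. F p (unit_at i) j * G (shift2 \<epsilon> p) (unit_at j) i')"
    by (rule G.apply_expand[OF pU' v])
  also have "\<dots> = (\<Sum>j | F p (unit_at i) j \<noteq> 0. F.coeff i j * G.coeff j i')"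
  proof (rule sum.cong[OF refl])
    fix j
    assume "j \<in> {j. F p (unit_at i) j \<noteq> 0}"
    then have j: "j \<in> fst B'" "shift2 \<epsilon> p \<in> snd B' j"
      using F.apply_unit_support(2)[OF i(1) p(1)] by blast+
    show "F p (unit_at i) j * G (shift2 \<epsilon> p) (unit_at j) i' = F.coeff i j * G.coeff j i'"
      using F.apply_unit_eq_coeff[OF i(1) j(1) p(1) j(2)] G.apply_unit_eq_coeff[OF j(1) i(2) j(2)] p(2)
      by (simp add: shift2_shift2)
  qed
  finally show ?thesis
    by simp
qed

text \<open>Hall's condition by comparison of ranks. The triangular product needs one finite set
  \<open>M\<close> of columns, while the composite sums over a support that varies with
  \<open>i\<close> and \<open>p\<close>. The two sums agree because all terms outside
  \<open>M \<inter> ?S\<close> vanish.\<close>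

lemma card_le_near:
  assumes A: "finite A" "A \<subseteq> long_set"
  shows "card A \<le> card (\<Union>i\<in>A. near_set i)"
proof -
  define M where "M = (\<Union>i\<in>A. near_set i)"
  have finM: "finite M"
    unfolding M_def using A finite_near_set by blast
  have M: "M \<subseteq> fst B'"
    by (auto simp: M_def)
  \<comment> \<open>Nonzero composites do not lower the rank, so together with \<open>R i i'\<close>
    they force equal ranks. What remains of \<open>R\<close> is the weight inequality needed for
    common points and for near intermediate bars.\<close>
  define R where "R i i' \<longleftrightarrow> ends_rank (e i') < ends_rank (e i) \<or>
    (ends_rank (e i) = ends_rank (e i') \<and> ends_weight (e i) \<le> ends_weight (e i'))" for i i'
  have R_rank: "ends_rank (e i') \<le> ends_rank (e i)" if "R i i'" for i i'
    using that by (auto simp: R_def)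
  have "card A \<le> card M"
  proof (rule card_le_of_triangular_product[OF A(1) finM, where R = R])
    fix S
    assume S: "S \<subseteq> A" "S \<noteq> {}"
    then have fin: "finite S"
      using A finite_subset by blast
    \<comment> \<open>An index maximal for \<open>R\<close> has the least rank and, among those, the
      greatest weight.\<close>
    define r where "r = Min ((\<lambda>i. ends_rank (e i)) ` S)"
    define T where "T = {i \<in> S. ends_rank (e i) = r}"
    have "r \<in> (\<lambda>i. ends_rank (e i)) ` S"
      unfolding r_def using fin S by (intro Min_in) auto
    then have T: "finite T" "T \<noteq> {}"
      using fin by (auto simp: T_def)
    define w where "w = Max ((\<lambda>i. ends_weight (e i)) ` T)"
    have "w \<in> (\<lambda>i. ends_weight (e i)) ` T"
      unfolding w_def using T by (intro Max_in) auto
    then obtain m where m: "m \<in> T" "ends_weight (e m) = w"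
      by blast
    have "R i m" if "i \<in> S" for i
    proof -
      have "r \<le> ends_rank (e i)"
        unfolding r_def using fin that by (intro Min_le) auto
      moreover have "ends_weight (e i) \<le> w" if "i \<in> T"
        unfolding w_def using T that by (intro Max_ge) auto
      ultimately show ?thesis
        using m that by (auto simp: R_def T_def)
    qed
    then show "\<exists>m\<in>S. \<forall>i\<in>S. R i m"
      using m(1) by (auto simp: T_def)
  next
    fix i i'
    assume ii: "i \<in> A" "i' \<in> A" "R i i'"
    then have i: "i \<in> fst B" "i' \<in> fst B" "long_ends (10 * \<epsilon>) (e i)"
      using A by auto
    let ?T = "\<lambda>j. F.coeff i j * G.coeff j i'"
    have hom: "ends_hom \<epsilon> (e i) (e' j)" "ends_hom \<epsilon> (e' j) (e i')" if "j \<in> fst B'" "?T j \<noteq> 0" for j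
      using that F.ends_hom_if_coeff[OF i(1)] G.ends_hom_if_coeff[OF _ i(2)] by auto
    show "(\<Sum>j\<in>M. ?T j) = (if i = i' then 1 else 0)"
    \<comment> \<open>On the diagonal the sum has to be 1, so a common point is required there even
      before any nonzero product is known.\<close>
    proof (cases "i = i' \<or> (\<exists>j\<in>fst B'. ?T j \<noteq> 0)")
      case False
      then show ?thesis
        using M by (auto intro!: sum.neutral)
    next
      case True
      have hom2: "ends_hom (2 * \<epsilon>) (e i) (e i')"
        using True
      proof
        assume "i = i'"
        then show ?thesis
          using ends_hom_refl F.eps by simp
      next
        assume "\<exists>j\<in>fst B'. ?T j \<noteq> 0"
        then show ?thesis
          using hom ends_hom_trans by (metis mult_2)
      qed
      have "ends_rank (e i) = ends_rank (e i')"
        using ends_rank_mono(1)[OF F.ends(1)[OF i(1)] F.ends(1)[OF i(2)] hom2] R_rank[OF ii(3)] by simp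
      then have weight: "ends_weight (e i) \<le> ends_weight (e i')"
        using ii(3) by (auto simp: R_def)
      obtain p where p: "p \<in> snd B i" "shift2 (2 * \<epsilon>) p \<in> snd B i'"
        using ends_hom_common_point[OF F.ends(1)[OF i(1)] F.ends(1)[OF i(2)] F.eps hom2
            R_rank[OF ii(3)] weight i(3)] F.ends(2) i by auto
      let ?S = "{j. F p (unit_at i) j \<noteq> 0}"
      note supp = F.apply_unit_support[OF i(1) p(1)]
      \<comment> \<open>A contributing bar is alive at the shifted point, so its scalar is a
        coordinate of the image and cannot vanish there.\<close>
      have "(\<Sum>j\<in>M. ?T j) = (\<Sum>j\<in>M \<inter> ?S. ?T j)"
      proof (rule sum.mono_neutral_right[OF finM Int_lower1], rule ballI)
        fix j
        assume "j \<in> M - M \<inter> ?S"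
        then have j: "j \<in> M" "F p (unit_at i) j = 0"
          by auto
        show "?T j = 0"
        proof (rule ccontr)
          assume nz: "?T j \<noteq> 0"
          have jB: "j \<in> fst B'"
            using j(1) M by blast
          have "shift2 \<epsilon> p \<in> snd B' j"
            using ends_hom_middle[OF hom[OF jB nz] F.eps] p F.ends(2) F.ends'(2) i jB by simp
          then have "F p (unit_at i) j = F.coeff i j"
            by (rule F.apply_unit_eq_coeff[OF i(1) jB p(1)])
          then show False
            using nz j(2) by simp
        qed
      qed
      \<comment> \<open>By the weight argument a contributing bar is near \<open>i\<close> or near
        \<open>i'\<close>; both belong to \<open>A\<close>, so the bar belongs to
        \<open>M\<close>.\<close>
      also have "\<dots> = (\<Sum>j\<in>?S. ?T j)"
      proof (rule sum.mono_neutral_left[OF supp(1) Int_lower2], rule ballI)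
        fix j
        assume "j \<in> ?S - M \<inter> ?S"
        then have j: "j \<notin> M" "F p (unit_at i) j \<noteq> 0"
          by auto
        show "?T j = 0"
        proof (rule ccontr)
          assume nz: "?T j \<noteq> 0"
          have jB: "j \<in> fst B'"
            using supp(2)[OF j(2)] by blast
          have "ends_near \<epsilon> (e i) (e' j) \<or> ends_near \<epsilon> (e' j) (e i')"
            by (rule ends_near_middle[OF F.ends(1)[OF i(1)] F.ends'(1)[OF jB] F.ends(1)[OF i(2)]
                  hom[OF jB nz] R_rank[OF ii(3)] weight])
          then show False
            using j(1) ii jB by (auto simp: M_def ends_near_sym)
        qed
      qed
      also have "\<dots> = (if i = i' then 1 else 0)"
        by (rule sum_coeff_products[OF i(1,2) p])
      finally show ?thesis .
    qed
  qed
  then show ?thesis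
    by (simp add: M_def)
qed

lemma near_injection: "\<exists>m. inj_on m long_set \<and> (\<forall>i\<in>long_set. m i \<in> near_set i)"
  using exists_injective_choice[of long_set near_set] finite_near_set card_le_near by blast

end

section \<open>From near bars to a matching of level set barcodes\<close>

lemma near_diagonal_part:
  assumes "ends_near \<epsilon> e e'" "0 \<le> \<epsilon>" "long_ends (10 * \<epsilon>) e"
  shows "diagonal_part (block_of e') \<noteq> {}"
  using assms ends_near_mid_point unfolding long_ends_def diagonal_part_def by blast

lemma long_ends_if_nontrivial:
  assumes "\<not> interval_trivial TYPE('k::field) \<delta> (diagonal_part (block_of e))"
  shows "long_ends \<delta> e"
  using assms unfolding interval_trivial_def vec_trivial_def long_ends_def
  by (auto simp: interval_module_def diagonal_part_def split: if_splits)

lemma long_ends_diagonal_part: "long_ends \<delta> e \<Longrightarrow> diagonal_part (block_of e) \<noteq> {}"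
  by (auto simp: long_ends_def diagonal_part_def)

lemma eps_matching_of_interleaving:
  assumes FG: "block_interleaving \<epsilon> B B' e e' F (G :: real \<times> real \<Rightarrow> ('j \<Rightarrow> 'k) \<Rightarrow> 'i \<Rightarrow> 'k)"
    and GF: "block_interleaving \<epsilon> B' B e' e G (F :: real \<times> real \<Rightarrow> ('i \<Rightarrow> 'k::field) \<Rightarrow> 'j \<Rightarrow> 'k)"
  shows "\<exists>I J \<sigma>. eps_matching TYPE('k) (5 * \<epsilon>) (level_barcode B) (level_barcode B') I J \<sigma>"
proof -
  interpret FG: block_interleaving \<epsilon> B B' e e' F G by fact
  interpret GF: block_interleaving \<epsilon> B' B e' e G F by fact
  note ends = FG.F.ends(2) and ends' = FG.F.ends'(2)
  let ?X = FG.long_set and ?Y = GF.long_set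
  obtain m where m: "inj_on m ?X" "\<forall>i\<in>?X. m i \<in> FG.near_set i"
    using FG.near_injection by blast
  obtain m' where m': "inj_on m' ?Y" "\<forall>j\<in>?Y. m' j \<in> GF.near_set j"
    using GF.near_injection by blast
  define E where "E i j \<longleftrightarrow> i \<in> fst B \<and> j \<in> fst B' \<and> ends_near \<epsilon> (e i) (e' j)" for i j
  have "E i (m i)" if "i \<in> ?X" for i
    using that m(2) by (auto simp: E_def)
  moreover have "E (m' j) j" if "j \<in> ?Y" for j
    using that m'(2) by (auto simp: E_def ends_near_sym)
  ultimately obtain \<sigma> I J where \<sigma>: "bij_betw \<sigma> I J" "?X \<subseteq> I" "?Y \<subseteq> J"
    "I \<subseteq> ?X \<union> m' ` ?Y" "J \<subseteq> ?Y \<union> m ` ?X" "\<forall>i\<in>I. E i (\<sigma> i)"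
    using merge_injections[OF m(1) _ m'(1), of E] by blast
  \<comment> \<open>Indices matched in addition to the long ones are near a long bar, so their
    blocks meet the diagonal and are not discarded.\<close>
  have "I \<subseteq> fst (level_barcode B)"
  proof
    fix i
    assume "i \<in> I"
    then have "i \<in> fst B \<and> diagonal_part (block_of (e i)) \<noteq> {}"
      using \<sigma>(4) m'(2) near_diagonal_part[OF _ FG.F.eps] long_ends_diagonal_part by blast
    then show "i \<in> fst (level_barcode B)"
      using ends by (simp add: level_barcode_def)
  qed
  moreover have "J \<subseteq> fst (level_barcode B')"
  proof
    fix j
    assume "j \<in> J"
    then have "j \<in> fst B' \<and> diagonal_part (block_of (e' j)) \<noteq> {}"
      using \<sigma>(5) m(2) near_diagonal_part[OF _ FG.F.eps] long_ends_diagonal_part by blast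
    then show "j \<in> fst (level_barcode B')"
      using ends' by (simp add: level_barcode_def)
  qed
  moreover have "i \<in> I" if "i \<in> fst (level_barcode B)"
    "\<not> interval_trivial TYPE('k) (2 * (5 * \<epsilon>)) (snd (level_barcode B) i)" for i
  proof -
    have "i \<in> fst B" "long_ends (10 * \<epsilon>) (e i)"
      using that ends long_ends_if_nontrivial[of "10 * \<epsilon>"] by (auto simp: level_barcode_def)
    then show ?thesis
      using \<sigma>(2) by blast
  qed
  moreover have "j \<in> J" if "j \<in> fst (level_barcode B')"
    "\<not> interval_trivial TYPE('k) (2 * (5 * \<epsilon>)) (snd (level_barcode B') j)" for j
  proof -
    have "j \<in> fst B'" "long_ends (10 * \<epsilon>) (e' j)"
      using that ends' long_ends_if_nontrivial[of "10 * \<epsilon>"] by (auto simp: level_barcode_def)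
    then show ?thesis
      using \<sigma>(3) by blast
  qed
  moreover have "interval_interleaved TYPE('k) (5 * \<epsilon>) (snd (level_barcode B) i) (snd (level_barcode B') (\<sigma> i))"
    if "i \<in> I" for i
  proof -
    have "E i (\<sigma> i)"
      using \<sigma>(6) that by blast
    then show ?thesis
      using interval_interleaved_if_near[OF _ FG.F.eps, where 'k = 'k] ends ends' by (simp add: E_def level_barcode_def)
  qed
  ultimately have "eps_matching TYPE('k) (5 * \<epsilon>) (level_barcode B) (level_barcode B') I J \<sigma>"
    using \<sigma>(1) unfolding eps_matching_def by blast
  then show ?thesis
    by blast
qed

section \<open>Coordinates with respect to a barcode\<close>

definition coordinate_iso ::
  "('i, (real \<times> real) set) family \<Rightarrow> (real \<times> real, 'k::field, 'v) vec_diagram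
    \<Rightarrow> (real \<times> real \<Rightarrow> 'v \<Rightarrow> 'i \<Rightarrow> 'k) \<Rightarrow> bool" where
  "coordinate_iso B M \<phi> \<longleftrightarrow>
     (\<forall>p\<in>upper_half. bij_betw (\<phi> p) (carrier (vec_at M p)) (fin_vecs B p) \<and>
        (\<forall>x\<in>carrier (vec_at M p). \<forall>y\<in>carrier (vec_at M p).
           \<phi> p (x \<oplus>\<^bsub>vec_at M p\<^esub> y) = (\<lambda>i. \<phi> p x i + \<phi> p y i)) \<and>
        (\<forall>a. \<forall>x\<in>carrier (vec_at M p). \<phi> p (a \<odot>\<^bsub>vec_at M p\<^esub> x) = (\<lambda>i. a * \<phi> p x i))) \<and>
     (\<forall>p\<in>upper_half. \<forall>q\<in>upper_half. le_oprr p q \<longrightarrow>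
        (\<forall>x\<in>carrier (vec_at M p). \<phi> q (vec_map M p q x) = cut_vec B q (\<phi> p x)))"

text \<open>Module records carry no axioms; these closure properties are used when sums, multiples
  and internal maps are moved to coordinates.\<close>

definition closed_diagram :: "(real \<times> real, 'k, 'v) vec_diagram \<Rightarrow> bool" where
  "closed_diagram M \<longleftrightarrow>
     (\<forall>p\<in>upper_half. abelian_monoid (vec_at M p) \<and>
        (\<forall>a. \<forall>x\<in>carrier (vec_at M p). a \<odot>\<^bsub>vec_at M p\<^esub> x \<in> carrier (vec_at M p))) \<and>
     (\<forall>p\<in>upper_half. \<forall>q\<in>upper_half. le_oprr p q \<longrightarrow>
        (\<forall>x\<in>carrier (vec_at M p). vec_map M p q x \<in> carrier (vec_at M q)))"

lemma closed_diagram_interlevel_homology: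
  "closed_diagram (interlevel_homology 0 X \<gamma> :: (real \<times> real, 'k::field, ('a, 'k) kchain set) vec_diagram)"
  unfolding closed_diagram_def interlevel_homology_def
proof (simp add: abelian_monoid_khomology smult_closed_khomology, intro ballI impI)
  fix p q and x :: "('a, 'k) kchain set"
  assume "p \<in> upper_half" "q \<in> upper_half" and le: "le_oprr p q"
    and "x \<in> carrier (khomology 0 (interlevel X \<gamma> p))"
  then obtain z where z: "z \<in> kchains 0 (interlevel X \<gamma> p)" "x = hclass (interlevel X \<gamma> p) z"
    by (auto simp: carrier_khomology)
  have "push (\<lambda>x. x) z \<in> kchains 0 (interlevel X \<gamma> q)"
    by (rule push_in_kchains[OF preserves_components_topspace[OF interlevel_mono[OF le]] z(1)])
  then show "khomology_map 0 (\<lambda>x. x) (interlevel X \<gamma> q) x \<in> carrier (khomology 0 (interlevel X \<gamma> q))"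
    unfolding z(2) khomology_map_inclusion[OF z(1) interlevel_mono[OF le]]
    by (simp add: push_id[OF z(1)] carrier_khomology)
qed

lemma coordinate_iso_exists:
  fixes M :: "(real \<times> real, 'k::field, 'v) vec_diagram"
  assumes "vec_diagram_iso upper_half le_oprr M
    (vec_direct_sum (fst B) (\<lambda>i. interval_module (snd B i)))" (is "vec_diagram_iso _ _ _ ?D")
  shows "\<exists>\<phi>. coordinate_iso B M \<phi>"
proof -
  obtain f where f: "vec_nat_trans upper_half le_oprr M ?D f"
    and bij: "\<And>p. p \<in> upper_half \<Longrightarrow> bij_betw (f p) (carrier (vec_at M p)) (carrier (vec_at ?D p))"
    using assms by (auto simp: vec_diagram_iso_def)
  \<comment> \<open>Elements of the direct sum are extensional; \<open>g\<close> replaces the value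
    outside the index set by 0.\<close>
  define g where "g x = (\<lambda>i. if i \<in> fst B then x i else 0)" for x :: "'a \<Rightarrow> 'k"
  have D: "carrier (vec_at ?D p) = {x \<in> \<Pi>\<^sub>E i\<in>fst B. if p \<in> snd B i then UNIV else {0}.
      finite {i \<in> fst B. x i \<noteq> 0}}" for p
    by (simp add: vec_direct_sum_def interval_module_def)
  have add: "g (x \<oplus>\<^bsub>vec_at ?D p\<^esub> y) = (\<lambda>i. g x i + g y i)" for x y p
    by (auto simp: g_def vec_direct_sum_def interval_module_def)
  have smult: "g (a \<odot>\<^bsub>vec_at ?D p\<^esub> x) = (\<lambda>i. a * g x i)" for a x p
    by (auto simp: g_def vec_direct_sum_def interval_module_def)
  have map: "g (vec_map ?D p q x) = cut_vec B q (g x)" if "x \<in> carrier (vec_at ?D p)" for p q x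
  proof
    fix i
    \<comment> \<open>The internal maps of an interval module test both \<open>p\<close> and
      \<open>q\<close>, \<open>cut_vec\<close> only \<open>q\<close>; for \<open>p\<close> outside
      the bar the coordinate is 0 already.\<close>
    have "i \<in> fst B \<Longrightarrow> p \<notin> snd B i \<Longrightarrow> x i = 0"
      using that unfolding D by (auto dest!: PiE_mem split: if_splits)
    then show "g (vec_map ?D p q x) i = cut_vec B q (g x) i"
      by (auto simp: g_def cut_vec_def vec_direct_sum_def interval_module_def)
  qed
  have g_bij: "bij_betw g (carrier (vec_at ?D p)) (fin_vecs B p)" for p
  proof (rule bij_betw_byWitness[where f' = "\<lambda>v. restrict v (fst B)"])
    show "\<forall>x\<in>carrier (vec_at ?D p). restrict (g x) (fst B) = x"
      unfolding D by (auto simp: g_def fun_eq_iff PiE_def extensional_def)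
    show "\<forall>v\<in>fin_vecs B p. g (restrict v (fst B)) = v"
      by (auto simp: g_def fin_vecs_def fun_eq_iff)
    show "g ` carrier (vec_at ?D p) \<subseteq> fin_vecs B p"
    proof (rule image_subsetI)
      fix x
      assume "x \<in> carrier (vec_at ?D p)"
      then have x: "finite {i \<in> fst B. x i \<noteq> 0}"
        "\<And>i. i \<in> fst B \<Longrightarrow> x i \<in> (if p \<in> snd B i then UNIV else {0})"
        unfolding D by (simp_all add: PiE_iff)
      have "{i. g x i \<noteq> 0} = {i \<in> fst B. x i \<noteq> 0}"
        by (auto simp: g_def)
      moreover have "i \<in> fst B \<and> p \<in> snd B i" if "g x i \<noteq> 0" for i
        using that x(2)[of i] by (auto simp: g_def split: if_splits)
      ultimately show "g x \<in> fin_vecs B p"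
        using x(1) by (simp add: fin_vecs_def)
    qed
    have "finite {i \<in> fst B. v i \<noteq> 0}" if "finite {i. v i \<noteq> 0}" for v :: "'a \<Rightarrow> 'k"
      using that by (rule finite_subset[rotated]) auto
    then show "(\<lambda>v. restrict v (fst B)) ` fin_vecs B p \<subseteq> carrier (vec_at ?D p)"
      unfolding D by (auto simp: fin_vecs_def cong: conj_cong)
  qed
  have "coordinate_iso B M (\<lambda>p x. g (f p x))"
    unfolding coordinate_iso_def
  proof (intro conjI ballI allI impI)
    fix p assume p: "p \<in> upper_half"
    show "bij_betw (\<lambda>x. g (f p x)) (carrier (vec_at M p)) (fin_vecs B p)"
      using bij_betw_trans[OF bij[OF p] g_bij] by (simp add: o_def)
    have lin: "linear_map_between (vec_at M p) (vec_at ?D p) (f p)"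
      using f p by (simp add: vec_nat_trans_def)
    show "g (f p (x \<oplus>\<^bsub>vec_at M p\<^esub> y)) = (\<lambda>i. g (f p x) i + g (f p y) i)"
      if "x \<in> carrier (vec_at M p)" "y \<in> carrier (vec_at M p)" for x y
      using lin that by (simp add: linear_map_between_def add)
    show "g (f p (a \<odot>\<^bsub>vec_at M p\<^esub> x)) = (\<lambda>i. a * g (f p x) i)"
      if "x \<in> carrier (vec_at M p)" for a x
      using lin that by (simp add: linear_map_between_def smult)
    show "g (f q (vec_map M p q x)) = cut_vec B q (g (f p x))"
      if "q \<in> upper_half" "le_oprr p q" "x \<in> carrier (vec_at M p)" for q x
    proof -
      have "f p x \<in> carrier (vec_at ?D p)"
        using bij_betwE[OF bij[OF p]] that(3) by blast
      moreover have "f q (vec_map M p q x) = vec_map ?D p q (f p x)"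
        using f p that unfolding vec_nat_trans_def by blast
      ultimately show ?thesis
        by (simp add: map)
    qed
  qed
  then show ?thesis
    by blast
qed

definition in_coordinates ::
  "real \<Rightarrow> (real \<times> real, 'k, 'v) vec_diagram \<Rightarrow> (real \<times> real \<Rightarrow> 'v \<Rightarrow> 'i \<Rightarrow> 'k)
    \<Rightarrow> (real \<times> real \<Rightarrow> 'w \<Rightarrow> 'j \<Rightarrow> 'k) \<Rightarrow> (real \<times> real \<Rightarrow> 'v \<Rightarrow> 'w)
    \<Rightarrow> real \<times> real \<Rightarrow> ('i \<Rightarrow> 'k) \<Rightarrow> 'j \<Rightarrow> 'k" where
  "in_coordinates \<epsilon> M \<phi> \<psi> f p v = \<psi> (shift2 \<epsilon> p) (f p (inv_into (carrier (vec_at M p)) (\<phi> p) v))"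

lemma in_coordinates_apply:
  assumes "coordinate_iso B M \<phi>" "p \<in> upper_half" "x \<in> carrier (vec_at M p)"
  shows "in_coordinates \<epsilon> M \<phi> \<psi> f p (\<phi> p x) = \<psi> (shift2 \<epsilon> p) (f p x)"
proof -
  have "bij_betw (\<phi> p) (carrier (vec_at M p)) (fin_vecs B p)"
    using assms(1,2) unfolding coordinate_iso_def by blast
  then show ?thesis
    unfolding in_coordinates_def using assms(3) by (simp only: bij_betw_inv_into_left)
qed

lemma coordinate_iso_obtain:
  assumes "coordinate_iso B M \<phi>" "p \<in> upper_half" "v \<in> fin_vecs B p"
  obtains x where "x \<in> carrier (vec_at M p)" "v = \<phi> p x"
  using assms unfolding coordinate_iso_def bij_betw_def by blast

lemma block_morphism_in_coordinates:
  fixes B :: "('i, (real \<times> real) set) family" and B' :: "('j, (real \<times> real) set) family"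
    and M :: "(real \<times> real, 'k::field, 'v) vec_diagram" and N :: "(real \<times> real, 'k, 'w) vec_diagram"
  assumes eps: "0 \<le> \<epsilon>"
    and ends: "\<And>i. i \<in> fst B \<Longrightarrow> admissible_ends (e i) \<and> snd B i = block_of (e i)"
    and ends': "\<And>j. j \<in> fst B' \<Longrightarrow> admissible_ends (e' j) \<and> snd B' j = block_of (e' j)"
    and M: "closed_diagram M" "coordinate_iso B M \<phi>" and N: "coordinate_iso B' N \<psi>"
    and f: "shifted_morphism \<epsilon> M N f"
  shows "block_morphism \<epsilon> B B' e e' (in_coordinates \<epsilon> M \<phi> \<psi> f)"
proof
  let ?F = "in_coordinates \<epsilon> M \<phi> \<psi> f"
  note app = in_coordinates_apply[OF M(2)] and obt = coordinate_iso_obtain[OF M(2)]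
  show "0 \<le> \<epsilon>" by (rule eps)
  show "i \<in> fst B \<Longrightarrow> admissible_ends (e i)" "i \<in> fst B \<Longrightarrow> snd B i = block_of (e i)" for i
    using ends by auto
  show "j \<in> fst B' \<Longrightarrow> admissible_ends (e' j)" "j \<in> fst B' \<Longrightarrow> snd B' j = block_of (e' j)" for j
    using ends' by auto
  fix p and v :: "'i \<Rightarrow> 'k"
  assume p: "p \<in> upper_half" and v: "v \<in> fin_vecs B p"
  note p' = shift2_in_upper_half[OF eps p]
  obtain x where x: "x \<in> carrier (vec_at M p)" "v = \<phi> p x"
    using obt[OF p v] .
  have lin: "linear_map_between (vec_at M p) (vec_at N (shift2 \<epsilon> p)) (f p)"
    using f p by (simp add: shifted_morphism_def)
  have fx: "f p x \<in> carrier (vec_at N (shift2 \<epsilon> p))" if "x \<in> carrier (vec_at M p)" for x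
    using lin that unfolding linear_map_between_def by blast
  have \<psi>: "bij_betw (\<psi> (shift2 \<epsilon> p)) (carrier (vec_at N (shift2 \<epsilon> p))) (fin_vecs B' (shift2 \<epsilon> p))"
    using N p' by (simp add: coordinate_iso_def)
  show "?F p v \<in> fin_vecs B' (shift2 \<epsilon> p)"
    using bij_betwE[OF \<psi>] fx[OF x(1)] by (simp add: x app[OF p])
  show "?F p (\<lambda>i. v i + w i) = (\<lambda>j. ?F p v j + ?F p w j)" if "w \<in> fin_vecs B p" for w
  proof -
    obtain y where y: "y \<in> carrier (vec_at M p)" "w = \<phi> p y"
      using obt[OF p \<open>w \<in> fin_vecs B p\<close>] .
    have "x \<oplus>\<^bsub>vec_at M p\<^esub> y \<in> carrier (vec_at M p)"
      using M(1) p x(1) y(1) by (simp add: closed_diagram_def abelian_monoid.a_closed)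
    moreover have "(\<lambda>i. v i + w i) = \<phi> p (x \<oplus>\<^bsub>vec_at M p\<^esub> y)"
      using M(2) p x y by (simp add: coordinate_iso_def)
    moreover have "\<psi> (shift2 \<epsilon> p) (f p (x \<oplus>\<^bsub>vec_at M p\<^esub> y)) =
        (\<lambda>j. \<psi> (shift2 \<epsilon> p) (f p x) j + \<psi> (shift2 \<epsilon> p) (f p y) j)"
      using lin x(1) y(1) fx N p' by (simp add: linear_map_between_def coordinate_iso_def)
    ultimately show ?thesis
      by (simp add: app[OF p] x y)
  qed
  show "?F p (\<lambda>i. c * v i) = (\<lambda>j. c * ?F p v j)" for c
  proof -
    have "c \<odot>\<^bsub>vec_at M p\<^esub> x \<in> carrier (vec_at M p)"
      using M(1) p x(1) by (simp add: closed_diagram_def)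
    moreover have "(\<lambda>i. c * v i) = \<phi> p (c \<odot>\<^bsub>vec_at M p\<^esub> x)"
      using M(2) p x by (simp add: coordinate_iso_def)
    moreover have "\<psi> (shift2 \<epsilon> p) (f p (c \<odot>\<^bsub>vec_at M p\<^esub> x)) = (\<lambda>j. c * \<psi> (shift2 \<epsilon> p) (f p x) j)"
      using lin x(1) fx N p' by (simp add: linear_map_between_def coordinate_iso_def)
    ultimately show ?thesis
      by (simp add: app[OF p] x)
  qed
  show "?F q (cut_vec B q v) = cut_vec B' (shift2 \<epsilon> q) (?F p v)"
    if q: "q \<in> upper_half" "le_oprr p q" for q
  proof -
    have "vec_map M p q x \<in> carrier (vec_at M q)"
      using M(1) p q x(1) by (simp add: closed_diagram_def)
    moreover have "cut_vec B q v = \<phi> q (vec_map M p q x)"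
      using M(2) p q x by (simp add: coordinate_iso_def)
    moreover have "f q (vec_map M p q x) = vec_map N (shift2 \<epsilon> p) (shift2 \<epsilon> q) (f p x)"
      using f p q x(1) unfolding shifted_morphism_def by blast
    moreover have "\<psi> (shift2 \<epsilon> q) (vec_map N (shift2 \<epsilon> p) (shift2 \<epsilon> q) (f p x)) =
        cut_vec B' (shift2 \<epsilon> q) (\<psi> (shift2 \<epsilon> p) (f p x))"
      using N p' shift2_in_upper_half[OF eps q(1)] le_oprr_shift2[OF q(2)] fx[OF x(1)]
      unfolding coordinate_iso_def by blast
    ultimately show ?thesis
      by (simp add: app[OF p] app[OF q(1)] x)
  qed
qed

lemma in_coordinates_comp:
  assumes eps: "0 \<le> \<epsilon>" and M: "coordinate_iso B M \<phi>" and N: "coordinate_iso B' N \<psi>"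
    and f: "shifted_morphism \<epsilon> M N f"
    and comp: "\<And>p x. p \<in> upper_half \<Longrightarrow> x \<in> carrier (vec_at M p) \<Longrightarrow>
      g (shift2 \<epsilon> p) (f p x) = vec_map M p (shift2 (2 * \<epsilon>) p) x"
    and p: "p \<in> upper_half" and v: "v \<in> fin_vecs B p"
  shows "in_coordinates \<epsilon> N \<psi> \<phi> g (shift2 \<epsilon> p) (in_coordinates \<epsilon> M \<phi> \<psi> f p v) =
    cut_vec B (shift2 (2 * \<epsilon>) p) v"
proof -
  note p' = shift2_in_upper_half[OF eps p]
  obtain x where x: "x \<in> carrier (vec_at M p)" "v = \<phi> p x"
    using coordinate_iso_obtain[OF M p v] .
  have "linear_map_between (vec_at M p) (vec_at N (shift2 \<epsilon> p)) (f p)"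
    using f p by (simp add: shifted_morphism_def)
  then have fx: "f p x \<in> carrier (vec_at N (shift2 \<epsilon> p))"
    using x(1) unfolding linear_map_between_def by blast
  have "\<phi> (shift2 (2 * \<epsilon>) p) (vec_map M p (shift2 (2 * \<epsilon>) p) x) = cut_vec B (shift2 (2 * \<epsilon>) p) (\<phi> p x)"
    using M p x(1) eps shift2_in_upper_half[of "2 * \<epsilon>" p] le_oprr_shift2_self[of "2 * \<epsilon>" p]
    by (simp add: coordinate_iso_def)
  then show ?thesis
    by (simp add: x in_coordinates_apply[OF M p] in_coordinates_apply[OF N p' fx] shift2_shift2 comp[OF p])
qed

text \<open>The coordinates of a finite spanning set involve finitely many bars only, and the basis
  vector of each bar alive at \<open>p\<close> lies in the span.\<close>

lemma finite_bars_at_point: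
  fixes M :: "(real \<times> real, 'k::field, 'v) vec_diagram"
  assumes M: "closed_diagram M" "coordinate_iso B M \<phi>" and p: "p \<in> upper_half"
    and fin: "fin_dim_space (vec_at M p)"
  shows "finite {i \<in> fst B. p \<in> snd B i}"
proof -
  let ?V = "vec_at M p"
  interpret V: abelian_monoid ?V
    using M(1) p by (simp add: closed_diagram_def)
  have smult: "a \<odot>\<^bsub>?V\<^esub> x \<in> carrier ?V" if "x \<in> carrier ?V" for a x
    using M(1) p that by (simp add: closed_diagram_def)
  note coords = bspec[OF conjunct1[OF M(2)[unfolded coordinate_iso_def]] p]
  have \<phi>: "bij_betw (\<phi> p) (carrier ?V) (fin_vecs B p)"
    using coords by (rule conjunct1)
  have \<phi>_add: "\<phi> p (x \<oplus>\<^bsub>?V\<^esub> y) = (\<lambda>i. \<phi> p x i + \<phi> p y i)"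
    if "x \<in> carrier ?V" "y \<in> carrier ?V" for x y
    by (rule bspec[OF bspec[OF conjunct1[OF conjunct2[OF coords]] that(1)] that(2)])
  have \<phi>_smult: "\<phi> p (a \<odot>\<^bsub>?V\<^esub> x) = (\<lambda>i. a * \<phi> p x i)" if "x \<in> carrier ?V" for a x
    using spec[OF conjunct2[OF conjunct2[OF coords]], of a] that by (rule bspec)
  have \<phi>_zero: "\<phi> p \<zero>\<^bsub>?V\<^esub> i = 0" for i
    using fun_cong[OF \<phi>_add[OF V.zero_closed V.zero_closed], of i]
    unfolding V.l_zero[OF V.zero_closed] by (simp only: add_cancel_right_right)
  obtain S where S: "S \<subseteq> carrier ?V" "finite S"
    and span: "\<forall>v\<in>carrier ?V. \<exists>a. v = (\<Oplus>\<^bsub>?V\<^esub>s\<in>S. a s \<odot>\<^bsub>?V\<^esub> s)"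
    using fin unfolding fin_dim_space_def by (elim exE conjE)
  define K where "K = (\<Union>s\<in>S. {i. \<phi> p s i \<noteq> 0})"
  have "\<phi> p s \<in> fin_vecs B p" if "s \<in> S" for s
    using bij_betwE[OF \<phi>] S(1) that by blast
  then have finK: "finite K"
    unfolding K_def by (intro finite_UN_I[OF S(2)]) (simp add: fin_vecs_def)
  have supp: "\<phi> p (\<Oplus>\<^bsub>?V\<^esub>s\<in>S'. a s \<odot>\<^bsub>?V\<^esub> s) i = 0" if "finite S'" "S' \<subseteq> S" "i \<notin> K" for S' a i
    using that
  proof (induction S' rule: finite_induct)
    case empty
    then show ?case
      by (simp add: \<phi>_zero)
  next
    case (insert s S')
    have s: "s \<in> carrier ?V" "(\<lambda>s. a s \<odot>\<^bsub>?V\<^esub> s) \<in> S' \<rightarrow> carrier ?V"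
      using insert.prems S(1) smult by auto
    have "\<phi> p s i = 0"
      using insert.prems by (auto simp: K_def)
    moreover have "\<phi> p (\<Oplus>\<^bsub>?V\<^esub>s\<in>S'. a s \<odot>\<^bsub>?V\<^esub> s) i = 0"
      using insert.IH insert.prems by simp
    moreover have "(\<Oplus>\<^bsub>?V\<^esub>s\<in>insert s S'. a s \<odot>\<^bsub>?V\<^esub> s) =
        a s \<odot>\<^bsub>?V\<^esub> s \<oplus>\<^bsub>?V\<^esub> (\<Oplus>\<^bsub>?V\<^esub>s\<in>S'. a s \<odot>\<^bsub>?V\<^esub> s)"
      by (rule V.finsum_insert[OF insert.hyps s(2) smult[OF s(1)]])
    ultimately show ?case
      by (simp add: \<phi>_add[OF smult[OF s(1)] V.finsum_closed[OF s(2)]] \<phi>_smult[OF s(1)])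
  qed
  have "i \<in> K" if i: "i \<in> fst B" "p \<in> snd B i" for i
  proof (rule ccontr)
    assume "i \<notin> K"
    obtain v where v: "v \<in> carrier ?V" "(unit_at i :: 'a \<Rightarrow> 'k) = \<phi> p v"
      using coordinate_iso_obtain[OF M(2) p unit_at_fin_vecs[OF i]] .
    obtain a where a: "v = (\<Oplus>\<^bsub>?V\<^esub>s\<in>S. a s \<odot>\<^bsub>?V\<^esub> s)"
      using bspec[OF span v(1)] by (elim exE)
    have "\<phi> p v i = 0"
      unfolding a by (rule supp[OF S(2) order_refl \<open>i \<notin> K\<close>])
    then show False
      using fun_cong[OF v(2), of i] by (simp add: unit_at_def)
  qed
  then show ?thesis
    by (intro finite_subset[OF _ finK]) auto
qed

lemma barcode_block_ends:
  assumes "is_block_barcode0 k X \<gamma> B"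
  shows "\<exists>e. \<forall>i\<in>fst B. admissible_ends (e i) \<and> snd B i = block_of (e i)"
  using assms is_block_ends unfolding is_block_barcode0_def by (intro bchoice) blast

text \<open>Over a diagonal point the interlevel set is a level set, whose homology is
  finite-dimensional by the Morse type condition.\<close>

lemma finite_bars_on_diagonal:
  assumes "reeb_graph TYPE('k::field) X \<gamma>"
    and "coordinate_iso B (interlevel_homology 0 X \<gamma>
      :: (real \<times> real, 'k, ('a, 'k) kchain set) vec_diagram) \<phi>"
  shows "finite {i \<in> fst B. (t, t) \<in> snd B i}"
proof (rule finite_bars_at_point[OF closed_diagram_interlevel_homology assms(2)])
  have "fin_dim_space (khomology 0 (preimage_space X \<gamma> {t}) :: ('k, ('a, 'k) kchain set) module)"
    using assms(1) unfolding reeb_graph_def morse_type_def by blast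
  then show "fin_dim_space (vec_at (interlevel_homology 0 X \<gamma>
      :: (real \<times> real, 'k, ('a, 'k) kchain set) vec_diagram) (t, t))"
    by (simp add: interlevel_homology_def interlevel_def)
qed (simp add: upper_half_def)

lemma eps_matching_of_reeb_interleaving:
  fixes X :: "'a topology" and Y :: "'b topology"
    and B :: "('i, (real \<times> real) set) family" and B' :: "('j, (real \<times> real) set) family"
  assumes X: "reeb_graph TYPE('k::field) X \<gamma>" and Y: "reeb_graph TYPE('k) Y \<kappa>"
    and B: "is_block_barcode0 TYPE('k) X \<gamma> B" and B': "is_block_barcode0 TYPE('k) Y \<kappa> B'"
    and eps: "0 \<le> \<epsilon>" and inter: "reeb_interleaved \<epsilon> X \<gamma> Y \<kappa>"
  shows "\<exists>I J \<sigma>. eps_matching TYPE('k) (5 * \<epsilon>) (level_barcode B) (level_barcode B') I J \<sigma>"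
proof -
  let ?M = "interlevel_homology 0 X \<gamma> :: (real \<times> real, 'k, ('a, 'k) kchain set) vec_diagram"
  let ?N = "interlevel_homology 0 Y \<kappa> :: (real \<times> real, 'k, ('b, 'k) kchain set) vec_diagram"
  obtain f g where f: "reeb_map \<epsilon> X \<gamma> Y \<kappa> f" and g: "reeb_map \<epsilon> Y \<kappa> X \<gamma> g"
    and gf: "\<And>p x. x \<in> set_at (reeb_functor X \<gamma>) p \<Longrightarrow>
      g (shift2 \<epsilon> p) (f p x) = set_map (reeb_functor X \<gamma>) p (shift2 (2 * \<epsilon>) p) x"
    and fg: "\<And>p y. y \<in> set_at (reeb_functor Y \<kappa>) p \<Longrightarrow>
      f (shift2 \<epsilon> p) (g p y) = set_map (reeb_functor Y \<kappa>) p (shift2 (2 * \<epsilon>) p) y"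
    using inter eps unfolding reeb_interleaved_def set_interleaved_def reeb_map_def by blast
  define f' where "f' = (reeb_map.homology_map \<epsilon> X \<gamma> Y \<kappa> f
    :: real \<times> real \<Rightarrow> ('a, 'k) kchain set \<Rightarrow> ('b, 'k) kchain set)"
  define g' where "g' = (reeb_map.homology_map \<epsilon> Y \<kappa> X \<gamma> g
    :: real \<times> real \<Rightarrow> ('b, 'k) kchain set \<Rightarrow> ('a, 'k) kchain set)"
  have f': "shifted_morphism \<epsilon> ?M ?N f'" and g': "shifted_morphism \<epsilon> ?N ?M g'"
    unfolding f'_def g'_def by (rule reeb_map.shifted_morphism_homology[OF f] reeb_map.shifted_morphism_homology[OF g])+
  have gf': "g' (shift2 \<epsilon> p) (f' p x) = vec_map ?M p (shift2 (2 * \<epsilon>) p) x"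
    if "p \<in> upper_half" "x \<in> carrier (vec_at ?M p)" for p x
    unfolding f'_def g'_def by (rule homology_map_comp[OF f g gf that])
  have fg': "f' (shift2 \<epsilon> p) (g' p y) = vec_map ?N p (shift2 (2 * \<epsilon>) p) y"
    if "p \<in> upper_half" "y \<in> carrier (vec_at ?N p)" for p y
    unfolding f'_def g'_def by (rule homology_map_comp[OF g f fg that])
  obtain e where e: "\<forall>i\<in>fst B. admissible_ends (e i) \<and> snd B i = block_of (e i)"
    using barcode_block_ends[OF B] by blast
  obtain e' where e': "\<forall>j\<in>fst B'. admissible_ends (e' j) \<and> snd B' j = block_of (e' j)"
    using barcode_block_ends[OF B'] by blast
  obtain \<phi> where \<phi>: "coordinate_iso B ?M \<phi>"
    using B coordinate_iso_exists unfolding is_block_barcode0_def by blast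
  obtain \<psi> where \<psi>: "coordinate_iso B' ?N \<psi>"
    using B' coordinate_iso_exists unfolding is_block_barcode0_def by blast
  let ?F = "in_coordinates \<epsilon> ?M \<phi> \<psi> f'" and ?G = "in_coordinates \<epsilon> ?N \<psi> \<phi> g'"
  have F: "block_morphism \<epsilon> B B' e e' ?F"
    by (rule block_morphism_in_coordinates[OF eps _ _ closed_diagram_interlevel_homology \<phi> \<psi> f'])
      (use e e' in auto)
  have G: "block_morphism \<epsilon> B' B e' e ?G"
    by (rule block_morphism_in_coordinates[OF eps _ _ closed_diagram_interlevel_homology \<psi> \<phi> g'])
      (use e e' in auto)
  have "block_interleaving \<epsilon> B B' e e' ?F ?G"
    unfolding block_interleaving_def block_interleaving_axioms_def
    using F G in_coordinates_comp[OF eps \<phi> \<psi> f' gf'] finite_bars_on_diagonal[OF Y \<psi>] by blast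
  moreover have "block_interleaving \<epsilon> B' B e' e ?G ?F"
    unfolding block_interleaving_def block_interleaving_axioms_def
    using F G in_coordinates_comp[OF eps \<psi> \<phi> g' fg'] finite_bars_on_diagonal[OF X \<phi>] by blast
  ultimately show ?thesis
    by (rule eps_matching_of_interleaving)
qed

theorem theorem4p13:
  fixes G :: "'a topology" and \<gamma> :: "'a \<Rightarrow> real"
    and G' :: "'b topology" and \<kappa> :: "'b \<Rightarrow> real"
    and B :: "('i, (real \<times> real) set) family"
    and B' :: "('j, (real \<times> real) set) family"
  assumes "reeb_graph TYPE('k::field) G \<gamma>"
    and "reeb_graph TYPE('k) G' \<kappa>"
    and "is_block_barcode0 TYPE('k) G \<gamma> B"
    and "is_block_barcode0 TYPE('k) G' \<kappa> B'"
    and "\<exists>\<epsilon>\<ge>0. reeb_interleaved \<epsilon> G \<gamma> G' \<kappa>"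
  shows "bottleneck_distance TYPE('k) (level_barcode B) (level_barcode B')
           \<le> 5 * reeb_distance G \<gamma> G' \<kappa>"
proof -
  let ?d = "bottleneck_distance TYPE('k) (level_barcode B) (level_barcode B')"
  have "?d \<le> 5 * ereal \<epsilon>" if "0 \<le> \<epsilon>" "reeb_interleaved \<epsilon> G \<gamma> G' \<kappa>" for \<epsilon>
  proof -
    have "?d \<le> ereal (5 * \<epsilon>)"
      unfolding bottleneck_distance_def
      using eps_matching_of_reeb_interleaving[OF assms(1-4) that] that(1)
      by (intro Inf_lower) auto
    then show ?thesis
      by simp
  qed
  \<comment> \<open>The factor is moved to the left so that the claim becomes a lower bound for the
    set whose infimum is \<open>reeb_distance\<close>.\<close>
  then have "?d / 5 \<le> reeb_distance G \<gamma> G' \<kappa>"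
    unfolding reeb_distance_def by (intro Inf_greatest) (auto simp: ereal_divide_le_pos)
  then show ?thesis
    by (simp add: ereal_divide_le_pos)
qed

end
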